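(* Let $R$ be a reduced ring with zero characteristic. Then either $R$ is submaximal or $\bigcap_{p\in\mathbb{P}} Rp=0$.
   Context: All rings are commutative with $1\neq 0$, and a subring of a ring contains the identity of that ring. A maximal subring of $R$ is a proper subring $S\subsetneq R$ such that there is no subring strictly between $S$ and $R$; $R$ is called submaximal if it has at least one maximal subring. $\mathbb{P}$ is the set of all prime numbers, and $Rp$ is the ideal of $R$ generated by $p\cdot 1_R$. *)

theory Defs
  imports "HOL-Algebra.Subrings" "HOL-Computational_Algebra.Primes"
begin

definition reduced_ring :: "('a, 'm) ring_scheme \<Rightarrow> bool" where
  "reduced_ring R \<longleftrightarrow>
     (\<forall>a \<in> carrier R. \<forall>n :: nat. a [^]\<^bsub>R\<^esub> n = \<zero>\<^bsub>R\<^esub> \<longrightarrow> a = \<zero>\<^bsub>R\<^esub>)"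

definition zero_characteristic :: "('a, 'm) ring_scheme \<Rightarrow> bool" where
  "zero_characteristic R \<longleftrightarrow> (\<forall>n :: nat. n > 0 \<longrightarrow> [n] \<cdot>\<^bsub>R\<^esub> \<one>\<^bsub>R\<^esub> \<noteq> \<zero>\<^bsub>R\<^esub>)"

(* The library's subring contains the identity of the ambient ring. *)
definition maximal_subring :: "'a set \<Rightarrow> ('a, 'm) ring_scheme \<Rightarrow> bool" where
  "maximal_subring S R \<longleftrightarrow>
     subring S R \<and> S \<subset> carrier R \<and> \<not> (\<exists>T. subring T R \<and> S \<subset> T \<and> T \<subset> carrier R)"

definition submaximal :: "('a, 'm) ring_scheme \<Rightarrow> bool" where
  "submaximal R \<longleftrightarrow> (\<exists>S. maximal_subring S R)"

end

theory Submission
  imports Defs "HOL-Computational_Algebra.Polynomial" "HOL-Library.Extended_Nat"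
begin

hide_const (open) UnivPoly.coeff UnivPoly.monom

text \<open>
  Suppose that a nonzero element \<open>z\<close> is divisible by every prime. As \<open>R\<close> is reduced, some prime
  ideal \<open>P\<close> omits \<open>z\<close>, and then the domain \<open>R / P\<close> has characteristic zero. Choose a prime \<open>p\<close> and
  \<open>r\<close> such that \<open>x = p r\<close> admits a discrete valuation on a subring with \<open>v p = 1\<close> and
  \<open>v (x - 1) \<ge> 1\<close>: if \<open>z\<close> is transcendental over the integers, take \<open>p = 2\<close>, \<open>x = z\<close> and a Gauss
  valuation in \<open>x - 1\<close>; otherwise some prime \<open>p\<close> is invertible modulo \<open>P\<close> and \<open>x = 1\<close>.
  A maximal extension of \<open>v\<close> by Gauss valuations has a domain over which everything is algebraic,
  and then a maximal compatible multiplicative filtration \<open>F\<close> of \<open>R\<close>, indexed by the integers,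
  exhausts \<open>R\<close>. For \<open>S = F\<^sub>0\<close> we have \<open>r \<notin> S\<close>, while \<open>S\<close> and \<open>r\<close> generate \<open>R\<close>: for every \<open>f\<close>
  and large \<open>n\<close> both \<open>(1 - x)\<^sup>n f\<close> and \<open>x\<^sup>n f = (p\<^sup>n f) r\<^sup>n\<close> lie in \<open>S[r]\<close>, and \<open>x\<close>, \<open>1 - x\<close> are
  comaximal. A subring containing \<open>S\<close> and maximal without \<open>r\<close> is a maximal subring.

  The argument takes place in a free commutative ring that maps onto \<open>R\<close>, with all ideals replaced
  by their preimages, so that type class algebra and polynomials over it are available.
\<close>
section \<open>Valuations modulo a prime ideal\<close>

definition is_subring :: "'b::comm_ring_1 set \<Rightarrow> bool" where
  "is_subring S \<longleftrightarrow> 1 \<in> S \<and> (\<forall>a\<in>S. \<forall>b\<in>S. a - b \<in> S \<and> a * b \<in> S)"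

lemma is_subringD:
  assumes "is_subring S"
  shows "1 \<in> S" "0 \<in> S" "a \<in> S \<Longrightarrow> b \<in> S \<Longrightarrow> a - b \<in> S"
    "a \<in> S \<Longrightarrow> b \<in> S \<Longrightarrow> a + b \<in> S" "a \<in> S \<Longrightarrow> b \<in> S \<Longrightarrow> a * b \<in> S"
    "a \<in> S \<Longrightarrow> - a \<in> S" "a \<in> S \<Longrightarrow> a ^ n \<in> S"
proof -
  note S = assms[unfolded is_subring_def]
  show one: "1 \<in> S" and diff: "a \<in> S \<Longrightarrow> b \<in> S \<Longrightarrow> a - b \<in> S" for a b
    using S by auto
  show mult: "a \<in> S \<Longrightarrow> b \<in> S \<Longrightarrow> a * b \<in> S" for a b using S by auto
  show zero: "0 \<in> S" using diff[OF one one] by simp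
  show neg: "a \<in> S \<Longrightarrow> - a \<in> S" for a using diff[OF zero] by fastforce
  show "a \<in> S \<Longrightarrow> b \<in> S \<Longrightarrow> a + b \<in> S" using diff[OF _ neg, of a b] by simp
  show "a \<in> S \<Longrightarrow> a ^ n \<in> S" by (induction n) (auto intro: one mult)
qed

lemma enat_add_less_le:
  fixes a b c d :: enat
  shows "a < c \<Longrightarrow> b \<le> d \<Longrightarrow> b \<noteq> \<infinity> \<Longrightarrow> a + b < c + d"
  by (cases a; cases b; cases c; cases d) auto

lemma is_subring_sum:
  assumes "is_subring S" "\<And>i. i \<in> I \<Longrightarrow> f i \<in> S"
  shows "sum f I \<in> S"
  using assms(2) by (induction I rule: infinite_finite_induct) (auto intro: is_subringD[OF assms(1)])

lemma is_subring_coeff_mult: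
  assumes "is_subring S" "\<And>i. coeff p i \<in> S" "\<And>i. coeff q i \<in> S"
  shows "coeff (p * q) i \<in> S"
  unfolding coeff_mult using assms by (auto intro!: is_subring_sum is_subringD(5))

text \<open>The quotient domain is never formed: equality in it is expressed as membership of a
  difference in \<open>P\<close>.\<close>

locale prime_ideal_set =
  fixes P :: "'a::comm_ring_1 set"
  assumes P_zero: "0 \<in> P"
    and P_diff: "a \<in> P \<Longrightarrow> b \<in> P \<Longrightarrow> a - b \<in> P"
    and P_mult: "a \<in> P \<Longrightarrow> a * b \<in> P"
    and P_one: "1 \<notin> P"
    and P_prime: "a * b \<in> P \<Longrightarrow> a \<in> P \<or> b \<in> P"
begin

lemma P_neg: "a \<in> P \<Longrightarrow> - a \<in> P"
  using P_diff[OF P_zero] by fastforce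

lemma P_add: "a \<in> P \<Longrightarrow> b \<in> P \<Longrightarrow> a + b \<in> P"
  using P_diff[OF _ P_neg] by fastforce

lemma P_mult': "a \<in> P \<Longrightarrow> b * a \<in> P"
  using P_mult by (metis mult.commute)

lemma P_sum: "(\<And>i. i \<in> I \<Longrightarrow> f i \<in> P) \<Longrightarrow> sum f I \<in> P"
  by (induction I rule: infinite_finite_induct) (auto intro: P_add P_zero)

lemma P_power: "a ^ n \<in> P \<Longrightarrow> a \<in> P"
  using P_one by (induction n) (auto dest: P_prime)

lemma P_cong: "a - b \<in> P \<Longrightarrow> a \<in> P \<longleftrightarrow> b \<in> P"
  using P_add[of "a - b" b] P_diff[of a "a - b"] by auto

lemma poly_mem_P: "(\<And>i. coeff q i \<in> P) \<Longrightarrow> poly q y \<in> P"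
  unfolding poly_altdef by (auto intro!: P_sum P_mult)

end

text \<open>For a subring \<open>A\<close> containing \<open>P\<close>, this is transcendence of the
  class of \<open>y\<close> modulo \<open>P\<close> over \<open>A / P\<close>.\<close>

definition transcendental_mod :: "'b::comm_ring_1 set \<Rightarrow> 'b set \<Rightarrow> 'b \<Rightarrow> bool" where
  "transcendental_mod P A y \<longleftrightarrow>
     (\<forall>q. (\<forall>i. coeff q i \<in> A) \<longrightarrow> poly q y \<in> P \<longrightarrow> (\<forall>i. coeff q i \<in> P))"

lemma transcendental_modD:
  "transcendental_mod P A y \<Longrightarrow> (\<And>i. coeff q i \<in> A) \<Longrightarrow> poly q y \<in> P \<Longrightarrow> coeff q i \<in> P"
  unfolding transcendental_mod_def by blast

text \<open>A valuation on the domain \<open>A / P\<close> with values in the naturals and infinity,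
  pulled back to \<open>A\<close>; outside \<open>A\<close> the function \<open>v\<close> is
  unconstrained.\<close>

locale valued_subring = prime_ideal_set P for P :: "'a::comm_ring_1 set" +
  fixes A :: "'a set" and v :: "'a \<Rightarrow> enat"
  assumes A_subring: "is_subring A"
    and P_subset_A: "P \<subseteq> A"
    and v_infinity: "a \<in> A \<Longrightarrow> v a = \<infinity> \<longleftrightarrow> a \<in> P"
    and v_mult: "a \<in> A \<Longrightarrow> b \<in> A \<Longrightarrow> v (a * b) = v a + v b"
    and v_diff: "a \<in> A \<Longrightarrow> b \<in> A \<Longrightarrow> min (v a) (v b) \<le> v (a - b)"
begin

lemmas A_closed = is_subringD[OF A_subring]

lemma v_zero: "v 0 = \<infinity>"
  using v_infinity[OF A_closed(2)] P_zero by simp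

lemma v_one: "v 1 = 0"
proof -
  have "v 1 = v 1 + v 1" using v_mult[OF A_closed(1) A_closed(1)] by simp
  moreover have "v 1 \<noteq> \<infinity>" using v_infinity[OF A_closed(1)] P_one by simp
  ultimately show ?thesis by (cases "v 1") (auto simp: zero_enat_def)
qed

lemma v_neg: assumes "a \<in> A" shows "v (- a) = v a"
proof -
  have *: "v b \<le> v (- b)" if "b \<in> A" for b
    using v_diff[OF A_closed(2) that] by (simp add: v_zero)
  show ?thesis using *[OF assms] *[OF A_closed(6)[OF assms]] by simp
qed

lemma v_add: "a \<in> A \<Longrightarrow> b \<in> A \<Longrightarrow> min (v a) (v b) \<le> v (a + b)"
  using v_diff[of a "- b"] v_neg[of b] A_closed(6)[of b] by simp

lemma v_sum:
  assumes "\<And>i. i \<in> I \<Longrightarrow> f i \<in> A" "\<And>i. i \<in> I \<Longrightarrow> n \<le> v (f i)"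
  shows "n \<le> v (sum f I)"
  using assms
proof (induction I rule: infinite_finite_induct)
  case (insert x F)
  then have "n \<le> min (v (f x)) (v (sum f F))" by simp
  also have "\<dots> \<le> v (f x + sum f F)"
    using insert by (intro v_add is_subring_sum[OF A_subring]) auto
  finally show ?case using insert by simp
qed (auto simp: v_zero)

lemma v_add_eq:
  assumes "a \<in> A" "b \<in> A" "v a < v b"
  shows "v (a + b) = v a"
proof (rule antisym)
  have "min (v (a + b)) (v b) \<le> v a"
    using v_diff[of "a + b" b] assms A_closed(4)[of a b] by simp
  then show "v (a + b) \<le> v a" using assms(3) by (auto simp: min_def split: if_splits)
  show "v a \<le> v (a + b)" using v_add[of a b] assms by (simp add: min_def less_imp_le)
qed

text \<open>For \<open>b\<close> outside \<open>P\<close> the value of \<open>b\<close> is finite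
  while \<open>a - b\<close> has value infinity, so \<open>v_add_eq\<close> applies. Hence
  \<open>v\<close> descends to the quotient by \<open>P\<close>.\<close>

lemma v_cong:
  assumes "a \<in> A" "b \<in> A" "a - b \<in> P"
  shows "v a = v b"
proof (cases "b \<in> P")
  case True
  then have "a \<in> P" using P_cong assms by blast
  then show ?thesis using True v_infinity assms by metis
next
  case False
  then have "v b < v (a - b)"
    using assms v_infinity[of b] v_infinity[of "a - b"] A_closed(3)[of a b] by simp
  then have "v (b + (a - b)) = v b" using assms A_closed(3)[of a b] by (intro v_add_eq) auto
  then show ?thesis by simp
qed

section \<open>Gauss valuations on polynomials over \<open>A\<close>\<close>

definition gauss :: "nat \<Rightarrow> 'a poly \<Rightarrow> enat" where
  "gauss w q = (INF i. v (coeff q i) + enat (i * w))"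

lemma gauss_le: "gauss w q \<le> v (coeff q i) + enat (i * w)"
  unfolding gauss_def by (rule INF_lower) simp

lemma gauss_ge: "(\<And>i. n \<le> v (coeff q i) + enat (i * w)) \<Longrightarrow> n \<le> gauss w q"
  unfolding gauss_def by (rule INF_greatest) simp

text \<open>\<open>enat\<close> is well-ordered, so the infimum over infinitely many indices is a
  minimum; indices past the degree contribute infinity.\<close>

lemma gauss_attained: "\<exists>i. gauss w q = v (coeff q i) + enat (i * w)"
proof -
  have "Inf (range (\<lambda>i. v (coeff q i) + enat (i * w))) \<in> range (\<lambda>i. v (coeff q i) + enat (i * w))"
    by (rule wellorder_InfI[OF rangeI])
  then show ?thesis unfolding gauss_def by blast
qed

lemma gauss_least_attained:
  obtains i where "gauss w q = v (coeff q i) + enat (i * w)"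
    "\<And>j. j < i \<Longrightarrow> gauss w q < v (coeff q j) + enat (j * w)"
proof -
  define i where "i = (LEAST i. gauss w q = v (coeff q i) + enat (i * w))"
  show ?thesis
  proof
    show "gauss w q = v (coeff q i) + enat (i * w)"
      unfolding i_def by (rule LeastI_ex[OF gauss_attained])
    show "gauss w q < v (coeff q j) + enat (j * w)" if "j < i" for j
      using not_less_Least[OF that[unfolded i_def]] gauss_le[of w q j] by (simp add: order_less_le)
  qed
qed

lemma gauss_diff:
  assumes "\<And>i. coeff p i \<in> A" "\<And>i. coeff q i \<in> A"
  shows "min (gauss w p) (gauss w q) \<le> gauss w (p - q)"
proof (rule gauss_ge)
  fix i
  have "min (gauss w p) (gauss w q) \<le> min (v (coeff p i)) (v (coeff q i)) + enat (i * w)"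
    using gauss_le[of w p i] gauss_le[of w q i] by (auto simp: min_def)
  also have "\<dots> \<le> v (coeff (p - q) i) + enat (i * w)"
    using v_diff[of "coeff p i" "coeff q i"] assms by (simp add: add_right_mono)
  finally show "min (gauss w p) (gauss w q) \<le> v (coeff (p - q) i) + enat (i * w)" .
qed

lemma gauss_infinity:
  assumes "\<And>i. coeff q i \<in> A"
  shows "gauss w q = \<infinity> \<longleftrightarrow> (\<forall>i. coeff q i \<in> P)"
proof
  assume *: "gauss w q = \<infinity>"
  show "\<forall>i. coeff q i \<in> P"
  proof
    fix i
    have "v (coeff q i) = \<infinity>"
      using gauss_le[of w q i] by (cases "v (coeff q i)") (auto simp: *)
    then show "coeff q i \<in> P" using v_infinity assms by blast
  qed
next
  assume "\<forall>i. coeff q i \<in> P"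
  then have "v (coeff q i) = \<infinity>" for i using v_infinity assms by blast
  then show "gauss w q = \<infinity>" using gauss_attained[of w q] by simp
qed

text \<open>Gauss's lemma: if \<open>i\<close> and \<open>j\<close> are the least indices at which
  the minima for \<open>p\<close> and \<open>q\<close> are attained, then the coefficient of index
  \<open>i + j\<close> of the product has exactly one summand of least value.\<close>

lemma gauss_mult:
  assumes p: "\<And>i. coeff p i \<in> A" and q: "\<And>i. coeff q i \<in> A"
  shows "gauss w (p * q) = gauss w p + gauss w q"
proof (rule antisym)
  have split: "v (coeff p i * coeff q j) + enat ((i + j) * w)
      = (v (coeff p i) + enat (i * w)) + (v (coeff q j) + enat (j * w))" for i j
  proof -
    have "enat ((i + j) * w) = enat (i * w) + enat (j * w)" by (simp add: distrib_right)
    then show ?thesis using p q by (simp only: v_mult ac_simps)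
  qed
  show "gauss w p + gauss w q \<le> gauss w (p * q)"
  proof (rule gauss_ge)
    fix k
    have *: "gauss w p + gauss w q \<le> v (coeff p i * coeff q (k - i)) + enat (k * w)" if "i \<le> k" for i
      using split[of i "k - i"] gauss_le[of w p i] gauss_le[of w q "k - i"] that
      by (simp add: add_mono)
    \<comment> \<open>The weight is moved to the left so that \<open>v_sum\<close> applies to the
      bare coefficients. Truncated subtraction is harmless, since the bound is only used after the
      weight is added back.\<close>
    have "(gauss w p + gauss w q) - enat (k * w) \<le> v (coeff (p * q) k)"
      unfolding coeff_mult
    proof (rule v_sum)
      fix i assume "i \<in> {..k}"
      then show "gauss w p + gauss w q - enat (k * w) \<le> v (coeff p i * coeff q (k - i))"
        using *[of i] by (cases "gauss w p + gauss w q"; cases "v (coeff p i * coeff q (k - i))") auto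
    qed (use p q A_closed(5) in auto)
    then show "gauss w p + gauss w q \<le> v (coeff (p * q) k) + enat (k * w)"
      by (cases "gauss w p + gauss w q"; cases "v (coeff (p * q) k)") auto
  qed
  show "gauss w (p * q) \<le> gauss w p + gauss w q"
  proof (cases "gauss w p = \<infinity> \<or> gauss w q = \<infinity>")
    case False
    obtain i where i: "gauss w p = v (coeff p i) + enat (i * w)"
      "\<And>j. j < i \<Longrightarrow> gauss w p < v (coeff p j) + enat (j * w)" using gauss_least_attained[of w p] by blast
    obtain j where j: "gauss w q = v (coeff q j) + enat (j * w)"
      "\<And>i. i < j \<Longrightarrow> gauss w q < v (coeff q i) + enat (i * w)" using gauss_least_attained[of w q] by blast
    define t where "t = v (coeff p i * coeff q j)"
    have t: "t + enat ((i + j) * w) = gauss w p + gauss w q"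
      unfolding t_def split i(1) j(1) ..
    have t_fin: "t \<noteq> \<infinity>"
    proof
      assume "t = \<infinity>"
      then have "gauss w p + gauss w q = \<infinity>" using t by simp
      then show False using False by (simp add: plus_eq_infty_iff_enat)
    qed
    have less: "t < v (coeff p k * coeff q (i + j - k))" if k: "k \<le> i + j" "k \<noteq> i" for k
    proof -
      have le: "gauss w p \<le> v (coeff p k) + enat (k * w)"
        "gauss w q \<le> v (coeff q (i + j - k)) + enat ((i + j - k) * w)" by (rule gauss_le)+
      have "k < i \<or> i + j - k < j" using k by linarith
      then have "gauss w p + gauss w q
        < (v (coeff p k) + enat (k * w)) + (v (coeff q (i + j - k)) + enat ((i + j - k) * w))"
      proof
        assume "k < i"
        then show ?thesis using False le(2) i(2)[of k] by (intro enat_add_less_le) auto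
      next
        assume "i + j - k < j"
        then have "gauss w q + gauss w p
          < (v (coeff q (i + j - k)) + enat ((i + j - k) * w)) + (v (coeff p k) + enat (k * w))"
          using False le(1) j(2)[of "i + j - k"] by (intro enat_add_less_le) auto
        then show ?thesis by (simp only: add.commute)
      qed
      then have "t + enat ((i + j) * w) < v (coeff p k * coeff q (i + j - k)) + enat ((i + j) * w)"
        using split[of k "i + j - k"] t k by simp
      then show ?thesis by (metis add_right_mono linorder_not_less)
    qed
    define r where "r = (\<Sum>k\<in>{..i + j} - {i}. coeff p k * coeff q (i + j - k))"
    have "r \<in> A" unfolding r_def using p q A_closed(5) by (intro is_subring_sum[OF A_subring]) auto
    \<comment> \<open>\<open>eSuc\<close> turns the strict bounds into weak ones, as
      \<open>v_sum\<close> requires; finiteness of \<open>t\<close> makes the result strict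
      again.\<close>
    have "eSuc t \<le> v r"
      unfolding r_def using p q A_closed(5) less by (intro v_sum) (auto intro: ileI1)
    then have "t < v r" using t_fin by (cases t; cases "v r") (auto simp: eSuc_enat)
    moreover have "coeff (p * q) (i + j) = coeff p i * coeff q j + r"
      unfolding coeff_mult r_def by (subst sum.remove[of _ i]) auto
    ultimately have "v (coeff (p * q) (i + j)) = t"
      unfolding t_def using v_add_eq[OF A_closed(5)[OF p q] \<open>r \<in> A\<close>] by simp
    then show ?thesis using gauss_le[of w "p * q" "i + j"] t by simp
  qed auto
qed

text \<open>Modulo \<open>P\<close> the ring \<open>A[y]\<close> is a polynomial ring over
  \<open>A / P\<close>, so the Gauss valuation in which the variable has value \<open>w\<close>
  carries over to it.\<close>

lemma valued_subring_gauss_extension: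
  assumes tr: "transcendental_mod P A y"
  obtains A' v' where "valued_subring P A' v'" "A \<subseteq> A'" "y \<in> A'"
    "\<And>a. a \<in> A \<Longrightarrow> v' a = v a" "v' y = enat w"
proof
  define A' where "A' = {poly q y |q. \<forall>i. coeff q i \<in> A}"
  define rep where "rep f = (SOME q. (\<forall>i. coeff q i \<in> A) \<and> poly q y = f)" for f
  define v' where "v' f = gauss w (rep f)" for f
  have rep: "coeff (rep f) i \<in> A" "poly (rep f) y = f" if "f \<in> A'" for f i
  proof -
    have "\<exists>q. (\<forall>i. coeff q i \<in> A) \<and> poly q y = f" using that unfolding A'_def by blast
    from someI_ex[OF this] show "coeff (rep f) i \<in> A" "poly (rep f) y = f"
      unfolding rep_def by auto
  qed
  have A'I: "poly q y \<in> A'" if "\<And>i. coeff q i \<in> A" for q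
    using that unfolding A'_def by blast
  have v': "v' (poly q y) = gauss w q" if q: "\<And>i. coeff q i \<in> A" for q
  proof -
    let ?r = "rep (poly q y)"
    have r: "coeff ?r i \<in> A" "poly ?r y = poly q y" for i using rep A'I q by auto
    \<comment> \<open>Two polynomials over \<open>A\<close> with the same value at \<open>y\<close>
      agree coefficientwise modulo \<open>P\<close>, so \<open>v'\<close> does not depend on the
      choice made by \<open>rep\<close>.\<close>
    have "coeff (?r - q) i \<in> P" for i
      by (rule transcendental_modD[OF tr]) (use r q A_closed(3) P_zero in auto)
    then have "v (coeff ?r i) = v (coeff q i)" for i by (intro v_cong r q) auto
    then show ?thesis unfolding v'_def gauss_def by simp
  qed
  have const: "coeff [:a:] i \<in> A" if "a \<in> A" for a i
    using that A_closed(2) by (cases i) auto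
  have lin: "coeff [:0, 1:] i \<in> A" for i
    using A_closed(1,2) by (auto simp: coeff_pCons split: nat.split)
  show "A \<subseteq> A'" using A'I[OF const] by auto
  show "y \<in> A'" using A'I[OF lin] by simp
  show "v' a = v a" if "a \<in> A" for a
  proof -
    have "gauss w [:a:] = v a"
    proof (rule antisym)
      show "gauss w [:a:] \<le> v a" using gauss_le[of w "[:a:]" 0] by (simp add: zero_enat_def[symmetric])
      show "v a \<le> gauss w [:a:]"
        by (rule gauss_ge) (auto simp: coeff_pCons v_zero zero_enat_def[symmetric] split: nat.split)
    qed
    then show ?thesis using v'[OF const[OF that]] by simp
  qed
  show "v' y = enat w"
  proof -
    have "gauss w [:0, 1:] = enat w"
    proof (rule antisym)
      show "gauss w [:0, 1:] \<le> enat w" using gauss_le[of w "[:0, 1:]" 1] by (simp add: v_one)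
      show "enat w \<le> gauss w [:0, 1:]"
        by (rule gauss_ge) (auto simp: coeff_pCons v_zero v_one split: nat.split)
    qed
    then show ?thesis using v'[OF lin] by simp
  qed
  show "valued_subring P A' v'"
  proof (unfold_locales)
    show "is_subring A'" unfolding is_subring_def
    proof (intro conjI ballI)
      show "1 \<in> A'" using A'I[OF const[OF A_closed(1)]] by simp
      fix a b assume ab: "a \<in> A'" "b \<in> A'"
      show "a - b \<in> A'" using A'I[of "rep a - rep b"] rep[OF ab(1)] rep[OF ab(2)] A_closed(3) by simp
      show "a * b \<in> A'"
        using A'I[of "rep a * rep b"] rep[OF ab(1)] rep[OF ab(2)] is_subring_coeff_mult[OF A_subring] by simp
    qed
    show "P \<subseteq> A'" using P_subset_A \<open>A \<subseteq> A'\<close> by blast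
    fix a assume a: "a \<in> A'"
    show "v' a = \<infinity> \<longleftrightarrow> a \<in> P"
      unfolding v'_def gauss_infinity[OF rep(1)[OF a]]
      using transcendental_modD[OF tr rep(1)[OF a]] poly_mem_P[of "rep a" y] rep(2)[OF a] by auto
    fix b assume b: "b \<in> A'"
    show "v' (a * b) = v' a + v' b"
      using v'[OF is_subring_coeff_mult[OF A_subring rep(1)[OF a] rep(1)[OF b]]]
        gauss_mult[OF rep(1)[OF a] rep(1)[OF b]] rep(2)[OF a] rep(2)[OF b]
      by (simp add: v'_def)
    show "min (v' a) (v' b) \<le> v' (a - b)"
      using v'[of "rep a - rep b"] A_closed(3)[OF rep(1)[OF a] rep(1)[OF b]]
        gauss_diff[OF rep(1)[OF a] rep(1)[OF b]] rep(2)[OF a] rep(2)[OF b]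
      by (simp add: v'_def)
  qed
qed

end

section \<open>Valued subrings as graphs, the p-adic example, and maximal extensions\<close>

definition valuation_graph :: "'b::comm_ring_1 set \<Rightarrow> ('b \<times> enat) set \<Rightarrow> bool" where
  "valuation_graph P C \<longleftrightarrow>
     (\<forall>a m n. (a, m) \<in> C \<longrightarrow> (a, n) \<in> C \<longrightarrow> m = n) \<and>
     (\<forall>a. (a, \<infinity>) \<in> C \<longleftrightarrow> a \<in> P) \<and> (1, 0) \<in> C \<and>
     (\<forall>a m b n. (a, m) \<in> C \<longrightarrow> (b, n) \<in> C \<longrightarrow>
        (a * b, m + n) \<in> C \<and> (\<exists>k\<ge>min m n. (a - b, k) \<in> C))"

lemma valuation_graphD:
  assumes "valuation_graph P C"
  shows "(a, m) \<in> C \<Longrightarrow> (a, n) \<in> C \<Longrightarrow> m = n"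
    and "(a, \<infinity>) \<in> C \<longleftrightarrow> a \<in> P"
    and "(1, 0) \<in> C"
    and "(a, m) \<in> C \<Longrightarrow> (b, n) \<in> C \<Longrightarrow> (a * b, m + n) \<in> C"
    and "(a, m) \<in> C \<Longrightarrow> (b, n) \<in> C \<Longrightarrow> \<exists>k\<ge>min m n. (a - b, k) \<in> C"
  using assms unfolding valuation_graph_def by (blast, blast, blast, blast, blast)

lemma chain_Union_common:
  assumes "subset.chain Z \<C>" "x \<in> \<Union>\<C>" "y \<in> \<Union>\<C>"
  obtains C where "C \<in> \<C>" "x \<in> C" "y \<in> C"
proof -
  obtain X Y where XY: "X \<in> \<C>" "x \<in> X" "Y \<in> \<C>" "y \<in> Y" using assms(2,3) by blast
  then have "X \<subseteq> Y \<or> Y \<subseteq> X" using assms(1) unfolding subset_chain_def by blast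
  then show ?thesis using XY that by blast
qed

context prime_ideal_set
begin

lemma valued_subring_imp_graph:
  assumes "valued_subring P A v"
  shows "valuation_graph P ((\<lambda>a. (a, v a)) ` A)"
proof -
  interpret valued_subring P A v by fact
  show ?thesis
    unfolding valuation_graph_def
  proof (intro conjI allI impI)
    show "((1, 0) \<in> (\<lambda>a. (a, v a)) ` A)" using A_closed(1) v_one by force
    show "(a, \<infinity>) \<in> (\<lambda>a. (a, v a)) ` A \<longleftrightarrow> a \<in> P" for a
      using v_infinity[of a] P_subset_A by (auto simp: image_iff)
    fix a m b n assume "(a, m) \<in> (\<lambda>a. (a, v a)) ` A" "(b, n) \<in> (\<lambda>a. (a, v a)) ` A"
    then have ab: "a \<in> A" "b \<in> A" "m = v a" "n = v b" by auto
    show "(a * b, m + n) \<in> (\<lambda>a. (a, v a)) ` A"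
      unfolding ab v_mult[OF ab(1,2), symmetric] by (intro imageI A_closed ab)
    show "\<exists>k\<ge>min m n. (a - b, k) \<in> (\<lambda>a. (a, v a)) ` A"
      using v_diff[OF ab(1,2)] A_closed(3)[OF ab(1,2)] ab by blast
  qed auto
qed

lemma graph_imp_valued_subring:
  assumes "valuation_graph P C"
  obtains A v where "valued_subring P A v" "C = (\<lambda>a. (a, v a)) ` A"
proof
  define v where "v a = (THE n. (a, n) \<in> C)" for a
  have v: "v a = n" if "(a, n) \<in> C" for a n
    unfolding v_def using assms that unfolding valuation_graph_def by (intro the_equality) auto
  have graph: "(a, v a) \<in> C" if "a \<in> Domain C" for a using that v by auto
  show "C = (\<lambda>a. (a, v a)) ` Domain C" using v graph by force
  have P: "(a, \<infinity>) \<in> C \<longleftrightarrow> a \<in> P" and one: "(1, 0) \<in> C" for a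
    using assms unfolding valuation_graph_def by blast+
  have mult: "(a * b, v a + v b) \<in> C" and diff: "\<exists>k\<ge>min (v a) (v b). (a - b, k) \<in> C"
    if "a \<in> Domain C" "b \<in> Domain C" for a b
    using assms graph[OF that(1)] graph[OF that(2)] unfolding valuation_graph_def by blast+
  show "valued_subring P (Domain C) v"
  proof unfold_locales
    show "is_subring (Domain C)"
      unfolding is_subring_def using one mult diff by blast
    show "P \<subseteq> Domain C" using P by blast
    show "v a = \<infinity> \<longleftrightarrow> a \<in> P" if "a \<in> Domain C" for a using graph[OF that] P v by metis
    show "v (a * b) = v a + v b" if "a \<in> Domain C" "b \<in> Domain C" for a b
      using v[OF mult[OF that]] .
    show "min (v a) (v b) \<le> v (a - b)" if "a \<in> Domain C" "b \<in> Domain C" for a b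
      using diff[OF that] v by blast
  qed
qed

text \<open>The p-adic valuation of the integers, extended to their sum with \<open>P\<close>.
  Characteristic zero modulo \<open>P\<close> makes the integer part of an element unique.\<close>

lemma valued_subring_integers:
  assumes int: "\<And>k::int. k \<noteq> 0 \<Longrightarrow> of_int k \<notin> P" and p: "prime (p::nat)"
  obtains A v where "valued_subring P A v" "A = {of_int k + b |k b. b \<in> P}" "v (of_nat p) = 1"
proof -
  \<comment> \<open>\<open>multiplicity\<close> has a finite value at 0, so the value infinity is
    set by hand.\<close>
  define w where "w k = (if k = 0 then \<infinity> else enat (multiplicity (int p) k))" for k
  define C where "C = {(of_int k + b, w k) |k b. b \<in> P}"
  have ip: "prime (int p)" "\<not> is_unit (int p)" using p by (auto simp: prime_int_nat_transfer)
  have w_mult: "w (k * l) = w k + w l" for k l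
    using prime_elem_multiplicity_mult_distrib[of "int p" k l] ip(1) by (auto simp: w_def)
  have w_ge: "enat n \<le> w k \<longleftrightarrow> int p ^ n dvd k" for n k
    using power_dvd_iff_le_multiplicity[of k "int p" n] ip(2) by (auto simp: w_def)
  have w_diff: "min (w k) (w l) \<le> w (k - l)" for k l
  proof (cases "min (w k) (w l)")
    case (enat n)
    then have "enat n \<le> w k" "enat n \<le> w l" by (auto simp: min_def split: if_splits)
    then show ?thesis using enat w_ge by (simp add: dvd_diff)
  next
    case infinity
    then have "w k = \<infinity>" "w l = \<infinity>" by (auto simp: min_def split: if_splits)
    then have "k = 0" "l = 0" by (auto simp: w_def split: if_splits)
    then show ?thesis by (simp add: w_def)
  qed
  have uniq: "k = l" if "of_int k + a = of_int l + b" "a \<in> P" "b \<in> P" for k l a b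
  proof -
    have "of_int (k - l) = b - a" using that(1) by (simp add: algebra_simps)
    then show ?thesis using int[of "k - l"] P_diff[OF that(3,2)] by auto
  qed
  have CI: "(of_int k + b, w k) \<in> C" if "b \<in> P" for k b using that unfolding C_def by blast
  have "valuation_graph P C"
    unfolding valuation_graph_def
  proof (intro conjI allI impI)
    show "m = n" if "(a, m) \<in> C" "(a, n) \<in> C" for a m n
      using that uniq unfolding C_def by blast
    show "(a, \<infinity>) \<in> C \<longleftrightarrow> a \<in> P" for a
    proof
      assume "(a, \<infinity>) \<in> C"
      then obtain k b where "a = of_int k + b" "w k = \<infinity>" "b \<in> P" unfolding C_def by auto
      then show "a \<in> P" by (auto simp: w_def split: if_splits)
    next
      assume "a \<in> P"
      then show "(a, \<infinity>) \<in> C" using CI[of a 0] by (simp add: w_def)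
    qed
    show "(1, 0) \<in> C" using CI[OF P_zero, of 1] ip(2) by (simp add: w_def zero_enat_def multiplicity_unit_right)
    fix a m b n assume "(a, m) \<in> C" "(b, n) \<in> C"
    then obtain k c l d where *: "a = of_int k + c" "m = w k" "c \<in> P" "b = of_int l + d" "n = w l" "d \<in> P"
      unfolding C_def by blast
    have "(of_int (k * l) + (of_int k * d + c * b), w (k * l)) \<in> C"
      by (intro CI P_add P_mult P_mult' *)
    moreover have "of_int (k * l) + (of_int k * d + c * b) = a * b"
      unfolding * by (simp add: algebra_simps)
    ultimately show "(a * b, m + n) \<in> C" using w_mult * by simp
    have "(of_int (k - l) + (c - d), w (k - l)) \<in> C" by (intro CI P_diff *)
    then show "\<exists>k\<ge>min m n. (a - b, k) \<in> C"
      using w_diff[of k l] * by (intro exI[of _ "w (k - l)"]) (auto simp: algebra_simps)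
  qed
  then obtain A v where Av: "valued_subring P A v" "C = (\<lambda>a. (a, v a)) ` A"
    by (rule graph_imp_valued_subring)
  show ?thesis
  proof
    show "valued_subring P A v" by fact
    have "A = fst ` C" unfolding Av(2) by force
    then show "A = {of_int k + b |k b. b \<in> P}" unfolding C_def by force
    have "(of_nat p, 1) \<in> C"
      using CI[OF P_zero, of "int p"] ip p by (simp add: w_def one_enat_def multiplicity_self prime_gt_0_nat)
    then show "v (of_nat p) = 1" unfolding Av(2) by auto
  qed
qed

lemma maximal_valued_subring:
  assumes "valued_subring P A0 v0"
  obtains A v where "valued_subring P A v" "A0 \<subseteq> A" "\<And>a. a \<in> A0 \<Longrightarrow> v a = v0 a"
    "\<And>y. \<not> transcendental_mod P A y"
proof -
  define C0 where "C0 = (\<lambda>a. (a, v0 a)) ` A0"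
  \<comment> \<open>Inclusion of graphs means extension of both the ring and the valuation, so
    unions of chains are upper bounds.\<close>
  define Z where "Z = {C. valuation_graph P C \<and> C0 \<subseteq> C}"
  have "\<exists>M\<in>Z. \<forall>X\<in>Z. M \<subseteq> X \<longrightarrow> X = M"
  proof (rule subset_Zorn_nonempty)
    have "C0 \<in> Z" using valued_subring_imp_graph[OF assms] by (simp add: Z_def C0_def)
    then show "Z \<noteq> {}" by blast
    fix \<C> assume ne: "\<C> \<noteq> {}" and ch: "subset.chain Z \<C>"
    have sub: "valuation_graph P C" "C0 \<subseteq> C" if "C \<in> \<C>" for C
      using that ch unfolding subset.chain_def Z_def by auto
    obtain C1 where C1: "C1 \<in> \<C>" using ne by blast
    have "valuation_graph P (\<Union>\<C>)"
      unfolding valuation_graph_def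
    proof (intro conjI allI impI)
      fix a m n assume "(a, m) \<in> \<Union>\<C>" "(a, n) \<in> \<Union>\<C>"
      then obtain C where "C \<in> \<C>" "(a, m) \<in> C" "(a, n) \<in> C" by (rule chain_Union_common[OF ch])
      then show "m = n" using valuation_graphD(1)[OF sub(1)] by blast
    next
      fix a show "(a, \<infinity>) \<in> \<Union>\<C> \<longleftrightarrow> a \<in> P"
        using C1 valuation_graphD(2)[OF sub(1)] by blast
    next
      show "(1, 0) \<in> \<Union>\<C>" using C1 valuation_graphD(3)[OF sub(1)] by blast
    next
      fix a m b n assume "(a, m) \<in> \<Union>\<C>" "(b, n) \<in> \<Union>\<C>"
      then obtain C where C: "C \<in> \<C>" "(a, m) \<in> C" "(b, n) \<in> C" by (rule chain_Union_common[OF ch])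
      show "(a * b, m + n) \<in> \<Union>\<C>" using valuation_graphD(4)[OF sub(1)[OF C(1)] C(2,3)] C(1) by blast
      show "\<exists>k\<ge>min m n. (a - b, k) \<in> \<Union>\<C>"
        using valuation_graphD(5)[OF sub(1)[OF C(1)] C(2,3)] C(1) by blast
    qed
    then show "\<Union>\<C> \<in> Z" using C1 sub(2)[OF C1] unfolding Z_def by blast
  qed
  then obtain M where M: "M \<in> Z" "\<And>X. X \<in> Z \<Longrightarrow> M \<subseteq> X \<Longrightarrow> X = M" by blast
  have "valuation_graph P M" using M(1) by (simp add: Z_def)
  then obtain A v where Av: "valued_subring P A v" "M = (\<lambda>a. (a, v a)) ` A"
    by (rule graph_imp_valued_subring)
  interpret valued_subring P A v by fact
  show ?thesis
  proof
    show "valued_subring P A v" by fact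
    have C0: "C0 \<subseteq> (\<lambda>a. (a, v a)) ` A" using M(1) Av(2) unfolding Z_def by blast
    then show "A0 \<subseteq> A" "\<And>a. a \<in> A0 \<Longrightarrow> v a = v0 a" unfolding C0_def by auto
    fix y
    show "\<not> transcendental_mod P A y"
    proof
      assume tr: "transcendental_mod P A y"
      \<comment> \<open>Any weight for \<open>y\<close> would give a larger valued subring; here it
        is 0.\<close>
      obtain A' v' where A': "valued_subring P A' v'" "A \<subseteq> A'" "y \<in> A'"
        "\<And>a. a \<in> A \<Longrightarrow> v' a = v a"
        using valued_subring_gauss_extension[OF tr, of 0 thesis] by simp
      define M' where "M' = (\<lambda>a. (a, v' a)) ` A'"
      have MM': "M \<subseteq> M'"
      proof
        fix x assume "x \<in> M"
        then obtain a where "a \<in> A" "x = (a, v a)" unfolding Av(2) by blast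
        then have "a \<in> A'" "x = (a, v' a)" using A'(2,4) by auto
        then show "x \<in> M'" unfolding M'_def by blast
      qed
      moreover have "M' \<in> Z"
        using valued_subring_imp_graph[OF A'(1)] C0 MM' unfolding Z_def Av(2) M'_def by simp
      ultimately have "M' = M" by (intro M(2))
      moreover have "(y, v' y) \<in> M'" unfolding M'_def using A'(3) by (rule imageI)
      ultimately have "y \<in> A" unfolding Av(2) by auto
      \<comment> \<open>An element of \<open>A\<close> is a root of a monic linear polynomial over
        \<open>A\<close>, so it is not transcendental.\<close>
      then have "coeff [:- y, 1:] i \<in> A" for i
        using A_closed by (auto simp: coeff_pCons split: nat.split)
      moreover have "poly [:- y, 1:] y \<in> P" by (simp add: P_zero)
      ultimately have "coeff [:- y, 1:] 1 \<in> P" by (rule transcendental_modD[OF tr])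
      then show False using P_one by simp
    qed
  qed
qed

end

section \<open>Extending filtrations\<close>

context valued_subring
begin

text \<open>A pair \<open>(a, n)\<close> in \<open>F\<close> means that \<open>a\<close> lies in
  step \<open>n\<close> of a ring filtration indexed by the integers. The first and last clauses
  make it induce on \<open>A\<close> exactly the filtration by \<open>v\<close>: the last one keeps
  an element of finite value \<open>h\<close> out of step \<open>h + 1\<close>.\<close>

definition filtration :: "('a \<times> int) set \<Rightarrow> bool" where
  "filtration F \<longleftrightarrow>
     (\<forall>a\<in>A. \<forall>k n. enat k \<le> v a \<longrightarrow> n \<le> int k \<longrightarrow> (a, n) \<in> F) \<and>
     (\<forall>a b n. (a, n) \<in> F \<longrightarrow> (b, n) \<in> F \<longrightarrow> (a - b, n) \<in> F) \<and>
     (\<forall>a b m n. (a, m) \<in> F \<longrightarrow> (b, n) \<in> F \<longrightarrow> (a * b, m + n) \<in> F) \<and>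
     (\<forall>s\<in>A. \<forall>h. v s = enat h \<longrightarrow> (s, int h + 1) \<notin> F)"

lemma filtration_v: "filtration {(a, n). a \<in> A \<and> (\<exists>k. enat k \<le> v a \<and> n \<le> int k)}"
  unfolding filtration_def
proof (intro conjI allI ballI impI)
  fix a b n
  assume "(a, n) \<in> {(a, n). a \<in> A \<and> (\<exists>k. enat k \<le> v a \<and> n \<le> int k)}"
    "(b, n) \<in> {(a, n). a \<in> A \<and> (\<exists>k. enat k \<le> v a \<and> n \<le> int k)}"
  then obtain k l where *: "a \<in> A" "b \<in> A" "enat k \<le> v a" "n \<le> int k" "enat l \<le> v b" "n \<le> int l" by auto
  have "enat (min k l) \<le> min (v a) (v b)"
    using *(3,5) by (meson enat_ord_simps(1) min.boundedI min.cobounded1 min.cobounded2 order_trans)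
  also have "\<dots> \<le> v (a - b)" by (intro v_diff *)
  finally show "(a - b, n) \<in> {(a, n). a \<in> A \<and> (\<exists>k. enat k \<le> v a \<and> n \<le> int k)}"
    using * A_closed(3) by (auto intro!: exI[of _ "min k l"])
next
  fix a b m n
  assume "(a, m) \<in> {(a, n). a \<in> A \<and> (\<exists>k. enat k \<le> v a \<and> n \<le> int k)}"
    "(b, n) \<in> {(a, n). a \<in> A \<and> (\<exists>k. enat k \<le> v a \<and> n \<le> int k)}"
  then obtain k l where *: "a \<in> A" "b \<in> A" "enat k \<le> v a" "m \<le> int k" "enat l \<le> v b" "n \<le> int l" by auto
  have "enat (k + l) \<le> v (a * b)" using add_mono[OF *(3,5)] * by (simp add: v_mult)
  then show "(a * b, m + n) \<in> {(a, n). a \<in> A \<and> (\<exists>k. enat k \<le> v a \<and> n \<le> int k)}"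
    using * A_closed(5) by (auto intro!: exI[of _ "k + l"])
qed auto

text \<open>Each closure clause involves at most two pairs at a time and the last clause only
  excludes pairs, so all of them pass to unions of chains.\<close>

lemma maximal_filtration:
  obtains F where "filtration F" "\<And>F'. filtration F' \<Longrightarrow> F \<subseteq> F' \<Longrightarrow> F' = F"
proof -
  have "\<exists>M\<in>Collect filtration. \<forall>X\<in>Collect filtration. M \<subseteq> X \<longrightarrow> X = M"
  proof (rule subset_Zorn_nonempty)
    show "Collect filtration \<noteq> {}" using filtration_v by blast
    fix \<C> assume ne: "\<C> \<noteq> {}" and ch: "subset.chain (Collect filtration) \<C>"
    have sub: "filtration C" if "C \<in> \<C>" for C
      using that ch unfolding subset.chain_def by auto
    obtain C1 where C1: "C1 \<in> \<C>" using ne by blast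
    have "filtration (\<Union>\<C>)"
      unfolding filtration_def
    proof (intro conjI allI ballI impI)
      fix a k n assume "a \<in> A" "enat k \<le> v a" "n \<le> int k"
      then show "(a, n) \<in> \<Union>\<C>" using C1 sub[OF C1] unfolding filtration_def by blast
    next
      fix a b n assume "(a, n) \<in> \<Union>\<C>" "(b, n) \<in> \<Union>\<C>"
      then obtain C where "C \<in> \<C>" "(a, n) \<in> C" "(b, n) \<in> C" by (rule chain_Union_common[OF ch])
      then show "(a - b, n) \<in> \<Union>\<C>" using sub[of C] unfolding filtration_def by blast
    next
      fix a b m n assume "(a, m) \<in> \<Union>\<C>" "(b, n) \<in> \<Union>\<C>"
      then obtain C where "C \<in> \<C>" "(a, m) \<in> C" "(b, n) \<in> C" by (rule chain_Union_common[OF ch])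
      then show "(a * b, m + n) \<in> \<Union>\<C>" using sub[of C] unfolding filtration_def by blast
    next
      fix s h assume "s \<in> A" "v s = enat h"
      then show "(s, int h + 1) \<notin> \<Union>\<C>" using sub unfolding filtration_def by blast
    qed
    then show "\<Union>\<C> \<in> Collect filtration" by blast
  qed
  then show ?thesis using that by auto
qed

end

locale filtered_ring = valued_subring +
  fixes F :: "('a \<times> int) set"
  assumes F: "filtration F"
begin

lemma F_A: "a \<in> A \<Longrightarrow> enat k \<le> v a \<Longrightarrow> n \<le> int k \<Longrightarrow> (a, n) \<in> F"
  using F unfolding filtration_def by blast

lemma F_diff: "(a, n) \<in> F \<Longrightarrow> (b, n) \<in> F \<Longrightarrow> (a - b, n) \<in> F"
  using F unfolding filtration_def by blast

lemma F_mult: "(a, m) \<in> F \<Longrightarrow> (b, n) \<in> F \<Longrightarrow> (a * b, m + n) \<in> F"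
  using F unfolding filtration_def by blast

lemma F_proper: "s \<in> A \<Longrightarrow> v s = enat h \<Longrightarrow> (s, int h + 1) \<notin> F"
  using F unfolding filtration_def by blast

lemma F_P: "a \<in> P \<Longrightarrow> (a, n) \<in> F"
  using F_A[of a "nat n" n] P_subset_A v_infinity[of a] by auto

lemma F_zero: "(0, n) \<in> F"
  using F_P P_zero .

lemma F_neg: "(a, n) \<in> F \<Longrightarrow> (- a, n) \<in> F"
  using F_diff[OF F_zero] by fastforce

lemma F_add: "(a, n) \<in> F \<Longrightarrow> (b, n) \<in> F \<Longrightarrow> (a + b, n) \<in> F"
  using F_diff[OF _ F_neg, of a n b] by simp

lemma F_one: "n \<le> 0 \<Longrightarrow> (1, n) \<in> F"
  using F_A[of 1 0 n] A_closed(1) v_one by (simp add: zero_enat_def)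

text \<open>The filtration decreases because 1 lies in every step of index at most 0.\<close>

lemma F_mono: "(a, n) \<in> F \<Longrightarrow> m \<le> n \<Longrightarrow> (a, m) \<in> F"
  using F_mult[OF _ F_one, of a n "m - n"] by simp

lemma F_power: "(a, n) \<in> F \<Longrightarrow> (a ^ k, int k * n) \<in> F"
  using F_mult[of a n] by (induction k) (auto simp: F_one distrib_right)

lemma F_sum: "(\<And>i. i \<in> I \<Longrightarrow> (f i, n) \<in> F) \<Longrightarrow> (sum f I, n) \<in> F"
  by (induction I rule: infinite_finite_induct) (auto intro: F_add F_zero)

text \<open>Weight at least \<open>k\<close> when the variable has weight \<open>n\<close>: the
  value of such a polynomial at an element of step \<open>n\<close> lies in step
  \<open>k\<close>.\<close>

definition wt :: "int \<Rightarrow> 'a poly \<Rightarrow> int \<Rightarrow> bool" where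
  "wt n q k \<longleftrightarrow> (\<forall>i. (coeff q i, k - int i * n) \<in> F)"

lemma wtD: "wt n q k \<Longrightarrow> (coeff q i, k - int i * n) \<in> F"
  unfolding wt_def by blast

lemma wt_diff: "wt n p k \<Longrightarrow> wt n q k \<Longrightarrow> wt n (p - q) k"
  unfolding wt_def by (auto intro: F_diff)

lemma wt_add: "wt n p k \<Longrightarrow> wt n q k \<Longrightarrow> wt n (p + q) k"
  unfolding wt_def by (auto intro: F_add)

lemma wt_mult:
  assumes "wt n p k" "wt n q l"
  shows "wt n (p * q) (k + l)"
  unfolding wt_def coeff_mult
proof (intro allI F_sum)
  fix i j :: nat assume "j \<in> {..i}"
  then have "(k - int j * n) + (l - int (i - j) * n) = k + l - int i * n"
    by (simp add: of_nat_diff algebra_simps)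
  then show "(coeff p j * coeff q (i - j), k + l - int i * n) \<in> F"
    using F_mult[OF wtD[OF assms(1), of j] wtD[OF assms(2), of "i - j"]] by argo
qed

lemma wt_monom: "(a, k - int i * n) \<in> F \<Longrightarrow> wt n (monom a i) k"
  unfolding wt_def by (auto simp: F_zero)

lemma wt_const: "(a, k) \<in> F \<Longrightarrow> wt n [:a:] k"
  using wt_monom[of a k 0 n] by (simp add: monom_0)

lemma wt_smult: "(a, k) \<in> F \<Longrightarrow> wt n q l \<Longrightarrow> wt n (smult a q) (k + l)"
  using wt_mult[OF wt_const] by fastforce

lemma wt_cancel_monom:
  assumes "wt n q k"
  shows "wt n (q - monom (coeff q d) d) k"
  by (intro wt_diff assms wt_monom wtD)

text \<open>Pseudo-division by the relation \<open>rel\<close>, keeping track of weights.\<close>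

lemma wt_reduce:
  assumes u: "(u, h) \<in> F" and r: "wt n r (h + int m * n)" "\<And>i. i \<ge> m \<Longrightarrow> coeff r i = 0"
    and rel: "u * f ^ m = poly r f"
  shows "(\<And>i. i \<ge> d \<Longrightarrow> coeff q i = 0) \<Longrightarrow> wt n q k \<Longrightarrow>
    \<exists>e q'. (\<forall>i\<ge>m. coeff q' i = 0) \<and> wt n q' (k + int e * h) \<and> u ^ e * poly q f = poly q' f"
proof (induction d arbitrary: q k)
  case 0
  then show ?case by (intro exI[of _ 0] exI[of _ q]) auto
next
  case (Suc d)
  show ?case
  proof (cases "Suc d \<le> m")
    case True
    then show ?thesis using Suc.prems by (intro exI[of _ 0] exI[of _ q]) auto
  next
    case False
    define c where "c = coeff q d"
    \<comment> \<open>This is \<open>u * q - c * X^(d - m) * (u * X^m - r)\<close>, whose last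
      factor vanishes at \<open>f\<close>. The degree bound drops at the cost of a factor
      \<open>u\<close>, and the weight grows by \<open>h\<close>.\<close>
    define q' where "q' = smult u (q - monom c d) + monom c (d - m) * r"
    have "coeff q' i = 0" if "i \<ge> d" for i
    proof -
      have "coeff (q - monom c d) i = 0"
        using that Suc.prems(1)[of i] by (cases "i = d") (auto simp: c_def)
      moreover have "coeff (monom c (d - m) * r) i = 0"
        using that False r(2)[of "i - (d - m)"] by (simp add: coeff_monom_mult)
      ultimately show ?thesis by (simp add: q'_def)
    qed
    moreover have "wt n q' (k + h)"
    proof -
      have "k - int d * n = (k - int m * n) - int (d - m) * n"
        using False by (simp add: of_nat_diff algebra_simps)
      then have "(c, (k - int m * n) - int (d - m) * n) \<in> F"
        using wtD[OF Suc.prems(2), of d] unfolding c_def by argo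
      then have "wt n (monom c (d - m)) (k - int m * n)" by (rule wt_monom)
      from wt_mult[OF this r(1)] have "wt n (monom c (d - m) * r) (k + h)"
        by (simp add: algebra_simps)
      moreover have "wt n (smult u (q - monom c d)) (k + h)"
        using wt_smult[OF u wt_cancel_monom[OF Suc.prems(2), of d]] by (simp add: c_def add.commute)
      ultimately show ?thesis unfolding q'_def by (intro wt_add)
    qed
    ultimately obtain e q'' where q'': "\<forall>i\<ge>m. coeff q'' i = 0" "wt n q'' (k + h + int e * h)"
      "u ^ e * poly q' f = poly q'' f"
      using Suc.IH[of q' "k + h"] by blast
    have "poly q' f = u * poly q f"
    proof -
      have "poly q' f = u * poly q f - u * (c * f ^ d) + c * f ^ (d - m) * (u * f ^ m)"
        unfolding q'_def rel by (simp add: poly_monom algebra_simps)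
      also have "c * f ^ (d - m) * (u * f ^ m) = u * (c * (f ^ (d - m) * f ^ m))"
        by (simp add: ac_simps)
      also have "f ^ (d - m) * f ^ m = f ^ d" using False by (simp flip: power_add)
      finally show ?thesis by simp
    qed
    then have "u ^ Suc e * poly q f = poly q'' f" using q''(3) by (simp add: ac_simps)
    then show ?thesis using q''(1,2)
      by (intro exI[of _ "Suc e"] exI[of _ q'']) (auto simp: algebra_simps)
  qed
qed

text \<open>In the associated graded ring of \<open>F\<close>, the class of \<open>u\<close> in
  degree \<open>h\<close> is that of an element of \<open>A\<close> of value \<open>h\<close>. Such
  elements serve as leading coefficients: they are closed under products, stable under terms of
  higher order, and never zero.\<close>

definition unit_of_value :: "nat \<Rightarrow> 'a \<Rightarrow> bool" where
  "unit_of_value h u \<longleftrightarrow> (\<exists>s\<in>A. v s = enat h \<and> (s - u, int h + 1) \<in> F)"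

lemma unit_of_value_F: "unit_of_value h u \<Longrightarrow> (u, int h) \<in> F"
proof -
  assume "unit_of_value h u"
  then obtain s where s: "s \<in> A" "v s = enat h" "(s - u, int h + 1) \<in> F"
    unfolding unit_of_value_def by blast
  have "(s - (s - u), int h) \<in> F"
    using F_A[of s h "int h"] s by (intro F_diff F_mono[OF s(3)]) auto
  then show ?thesis by simp
qed

lemma unit_of_value_mult:
  assumes "unit_of_value h u" "unit_of_value h' u'"
  shows "unit_of_value (h + h') (u * u')"
proof -
  obtain s s' where s: "s \<in> A" "v s = enat h" "(s - u, int h + 1) \<in> F"
    and s': "s' \<in> A" "v s' = enat h'" "(s' - u', int h' + 1) \<in> F"
    using assms unfolding unit_of_value_def by blast
  have "(s - u) * s' + u * (s' - u') = s * s' - u * u'" by (simp add: algebra_simps)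
  moreover have "((s - u) * s' + u * (s' - u'), int (h + h') + 1) \<in> F"
    using F_mult[OF s(3) F_A[of s' h' "int h'"]] F_mult[OF unit_of_value_F[OF assms(1)] s'(3)] s'
    by (intro F_add) (auto simp: algebra_simps)
  ultimately have "(s * s' - u * u', int (h + h') + 1) \<in> F" by simp
  then show ?thesis unfolding unit_of_value_def
    using s s' v_mult A_closed(5) by (intro bexI[of _ "s * s'"]) auto
qed

lemma unit_of_value_power: "unit_of_value h u \<Longrightarrow> unit_of_value (k * h) (u ^ k)"
proof (induction k)
  case 0
  show ?case unfolding unit_of_value_def
    using A_closed(1) v_one F_zero by (intro bexI[of _ 1]) (auto simp: zero_enat_def)
next
  case (Suc k)
  then show ?case using unit_of_value_mult by fastforce
qed

lemma unit_of_value_diff: "unit_of_value h u \<Longrightarrow> (b, int h + 1) \<in> F \<Longrightarrow> unit_of_value h (u - b)"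
proof -
  assume u: "unit_of_value h u" and b: "(b, int h + 1) \<in> F"
  then obtain s where s: "s \<in> A" "v s = enat h" "(s - u, int h + 1) \<in> F"
    unfolding unit_of_value_def by blast
  then have "(s - (u - b), int h + 1) \<in> F" using F_add[OF s(3) b] by (simp add: algebra_simps)
  then show ?thesis using s unfolding unit_of_value_def by blast
qed

lemma unit_of_value_nonzero: "\<not> unit_of_value h 0"
  unfolding unit_of_value_def using F_proper by auto

text \<open>Placing \<open>f\<close> in step \<open>n\<close> generates a family \<open>F'\<close>
  strictly larger than \<open>F\<close> that satisfies all closure conditions. Maximality forces it
  to violate the last clause of \<open>filtration\<close>, and the violation is the required
  witness.\<close>

lemma filtration_adjoin:
  assumes max: "\<And>F'. filtration F' \<Longrightarrow> F \<subseteq> F' \<Longrightarrow> F' = F" and notin: "(f, n) \<notin> F"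
  obtains s h q where "s \<in> A" "v s = enat h" "s = poly q f" "wt n q (int h + 1)"
proof -
  define F' where "F' = {(poly q f, k) |q k. wt n q k}"
  have I: "(poly q f, k) \<in> F'" if "wt n q k" for q k using that unfolding F'_def by blast
  have sub: "F \<subseteq> F'"
  proof
    fix x assume "x \<in> F"
    then show "x \<in> F'" using I[OF wt_const, of "fst x" "snd x"] by (cases x) simp
  qed
  have "(poly (monom 1 1) f, n) \<in> F'" by (rule I, rule wt_monom) (simp add: F_one)
  then have "(f, n) \<in> F'" by (simp add: poly_monom)
  then have "F' \<noteq> F" using notin by blast
  then have "\<not> filtration F'" using max sub by blast
  moreover have "\<forall>a\<in>A. \<forall>k n. enat k \<le> v a \<longrightarrow> n \<le> int k \<longrightarrow> (a, n) \<in> F'"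
    using F_A sub by blast
  moreover have "\<forall>a b n. (a, n) \<in> F' \<longrightarrow> (b, n) \<in> F' \<longrightarrow> (a - b, n) \<in> F'"
  proof (intro allI impI)
    fix a b k assume "(a, k) \<in> F'" "(b, k) \<in> F'"
    then obtain p q where "a = poly p f" "b = poly q f" "wt n p k" "wt n q k" unfolding F'_def by blast
    then show "(a - b, k) \<in> F'" using I[OF wt_diff] by fastforce
  qed
  moreover have "\<forall>a b m n. (a, m) \<in> F' \<longrightarrow> (b, n) \<in> F' \<longrightarrow> (a * b, m + n) \<in> F'"
  proof (intro allI impI)
    fix a b k l assume "(a, k) \<in> F'" "(b, l) \<in> F'"
    then obtain p q where "a = poly p f" "b = poly q f" "wt n p k" "wt n q l" unfolding F'_def by blast
    then show "(a * b, k + l) \<in> F'" using I[OF wt_mult] by fastforce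
  qed
  ultimately obtain s h where "s \<in> A" "v s = enat h" "(s, int h + 1) \<in> F'"
    unfolding filtration_def by blast
  then show ?thesis using that unfolding F'_def by blast
qed

text \<open>A maximal filtration is integrally closed in a weighted sense. Induction on
  \<open>m\<close>: if \<open>f\<close> were missing from step \<open>n\<close>, the relation from
  \<open>filtration_adjoin\<close> would lower the degree of the given one, down to degree 0, where
  it says that a \<open>unit_of_value\<close> is zero.\<close>

lemma filtration_integral:
  assumes max: "\<And>F'. filtration F' \<Longrightarrow> F \<subseteq> F' \<Longrightarrow> F' = F"
  shows "unit_of_value h u \<Longrightarrow> (\<And>i. i \<ge> m \<Longrightarrow> coeff r i = 0) \<Longrightarrow> wt n r (int h + int m * n) \<Longrightarrow>
    u * f ^ m = poly r f \<Longrightarrow> (f, n) \<in> F"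
proof (induction m arbitrary: h u r)
  case 0
  have "r = 0" using "0.prems"(2) by (intro poly_eqI) simp
  then show ?case using "0.prems"(1,4) unit_of_value_nonzero by simp
next
  case (Suc m)
  show ?case
  proof (rule ccontr)
    assume "(f, n) \<notin> F"
    with max obtain s g b where s: "s \<in> A" "v s = enat g" "s = poly b f" "wt n b (int g + 1)"
      by (rule filtration_adjoin)
    \<comment> \<open>The expression of \<open>s\<close> is multiplied by \<open>f ^ m\<close>
      before reduction, so that the reduced polynomial \<open>q\<close> of degree at most
      \<open>m\<close> can be compared with \<open>u ^ e * s * f ^ m\<close>.\<close>
    have "wt n (monom 1 m) (int m * n)" by (rule wt_monom) (simp add: F_one)
    with s(4) have "wt n (b * monom 1 m) (int g + 1 + int m * n)" by (rule wt_mult)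
    moreover have "coeff (b * monom 1 m) i = 0" if "i \<ge> Suc (degree (b * monom 1 m))" for i
      using that by (intro coeff_eq_0) simp
    ultimately obtain e q where q: "\<forall>i\<ge>Suc m. coeff q i = 0"
      "wt n q (int g + 1 + int m * n + int e * int h)" "u ^ e * poly (b * monom 1 m) f = poly q f"
      using wt_reduce[OF unit_of_value_F[OF Suc.prems(1)] Suc.prems(3,2,4)] by blast
    define c where "c = coeff q m"
    \<comment> \<open>The surplus 1 in the weight of \<open>b\<close> puts \<open>c\<close> one step
      above \<open>e * h + g\<close>, so subtracting it from \<open>u ^ e * s\<close> leaves an
      admissible leading coefficient.\<close>
    have c: "(c, int (e * h + g) + 1) \<in> F"
      using wtD[OF q(2), of m] by (simp add: c_def algebra_simps)
    have "unit_of_value g s" unfolding unit_of_value_def using s F_zero by (intro bexI[of _ s]) auto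
    then have "unit_of_value (e * h + g) (u ^ e * s - c)"
      using c Suc.prems(1) by (intro unit_of_value_diff unit_of_value_mult unit_of_value_power)
    moreover have "coeff (q - monom c m) i = 0" if "i \<ge> m" for i
      using that q(1) by (cases "i = m") (auto simp: c_def)
    moreover have "wt n (q - monom c m) (int (e * h + g) + int m * n)"
      unfolding wt_def
    proof
      fix i
      show "(coeff (q - monom c m) i, int (e * h + g) + int m * n - int i * n) \<in> F"
        using wtD[OF wt_cancel_monom[OF q(2)], of m i] unfolding c_def
        by (rule F_mono) (simp add: algebra_simps)
    qed
    moreover have "(u ^ e * s - c) * f ^ m = poly (q - monom c m) f"
      using q(3) by (simp add: s(3)[symmetric] poly_monom algebra_simps)
    ultimately have "(f, n) \<in> F" by (rule Suc.IH)
    with \<open>(f, n) \<notin> F\<close> show False by blast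
  qed
qed

text \<open>The leading coefficient of a relation may lie in \<open>P\<close>. Discarding all terms
  beyond the last coefficient outside \<open>P\<close> changes the value at \<open>f\<close> only by
  an element of \<open>P\<close>.\<close>

lemma not_transcendental_leading_coeff:
  assumes "\<not> transcendental_mod P A f"
  obtains q m where "\<And>i. coeff q i \<in> A" "coeff q m \<notin> P" "\<And>i. i > m \<Longrightarrow> coeff q i = 0" "poly q f \<in> P"
proof -
  obtain q j where q: "\<And>i. coeff q i \<in> A" "poly q f \<in> P" "coeff q j \<notin> P"
    using assms unfolding transcendental_mod_def by blast
  have bound: "i \<le> degree q" if "coeff q i \<notin> P" for i
    using that P_zero le_degree by metis
  define m where "m = (GREATEST i. coeff q i \<notin> P)"
  have m: "coeff q m \<notin> P" unfolding m_def 
    by (rule GreatestI_nat[where P = "\<lambda>i. coeff q i \<notin> P", OF q(3) bound])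
  have m_max: "coeff q i \<in> P" if "i > m" for i
    using Greatest_le_nat[of "\<lambda>i. coeff q i \<notin> P" i "degree q"] bound that unfolding m_def by fastforce
  define p where "p = poly_cutoff (Suc m) q"
  have p: "coeff p i = (if i \<le> m then coeff q i else 0)" for i
    unfolding p_def by (simp add: coeff_poly_cutoff)
  have "poly (q - p) f \<in> P"
    by (rule poly_mem_P) (simp add: p m_max P_zero)
  then have "poly q f - poly p f \<in> P" by simp
  with q(2) have "poly p f \<in> P" using P_cong by blast
  then show ?thesis using that[of p m] p q(1) m A_closed(2) by auto
qed

lemma filtration_exhaustive:
  assumes max: "\<And>F'. filtration F' \<Longrightarrow> F \<subseteq> F' \<Longrightarrow> F' = F" and alg: "\<not> transcendental_mod P A f"
  shows "\<exists>n. (f, n) \<in> F"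
proof -
  obtain q m where q: "\<And>i. coeff q i \<in> A" "coeff q m \<notin> P" "\<And>i. i > m \<Longrightarrow> coeff q i = 0" "poly q f \<in> P"
    using not_transcendental_leading_coeff[OF alg] by blast
  define u where "u = coeff q m"
  \<comment> \<open>Keeping the constant \<open>poly q f\<close> makes
    \<open>u * f ^ m = poly r f\<close> hold exactly and not only modulo \<open>P\<close>.\<close>
  define r where "r = [:poly q f:] - (q - monom u m)"
  have "u \<in> A" unfolding u_def by (rule q(1))
  obtain h where h: "v u = enat h"
    using v_infinity[OF \<open>u \<in> A\<close>] q(2) unfolding u_def by (cases "v (coeff q m)") auto
  have "m \<noteq> 0"
  proof
    assume "m = 0"
    then have "q = [:u:]" using q(3) by (intro poly_eqI) (auto simp: u_def coeff_pCons split: nat.split)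
    then have "poly q f = u" by simp
    then show False using q(2,4) unfolding u_def by simp
  qed
  have "unit_of_value h u" unfolding unit_of_value_def
    using \<open>u \<in> A\<close> h F_zero by (intro bexI[of _ u]) auto
  moreover have r0: "coeff r i = 0" if "i \<ge> m" for i
    using that q(3)[of i] \<open>m \<noteq> 0\<close> by (cases "i = m") (auto simp: r_def u_def coeff_pCons split: nat.split)
  \<comment> \<open>With \<open>- int h\<close> as the weight of \<open>f\<close>, the steps
    demanded of the coefficients below \<open>m\<close> have index at most 0, so membership in
    \<open>A\<close> suffices.\<close>
  moreover have "wt (- int h) r (int h + int m * (- int h))"
    unfolding wt_def
  proof
    fix i
    show "(coeff r i, int h + int m * - int h - int i * - int h) \<in> F"
    proof (cases "i < m")
      case True
      have "coeff r i \<in> A"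
        using True q(1) q(4) P_subset_A A_closed
        by (auto simp: r_def coeff_pCons split: nat.split)
      moreover have "int h + int m * - int h - int i * - int h \<le> int 0"
      proof -
        have "int (Suc i) * int h \<le> int m * int h" using True by (intro mult_right_mono) auto
        then show ?thesis by (simp add: algebra_simps)
      qed
      ultimately show ?thesis by (intro F_A[where k = 0]) (auto simp: zero_enat_def[symmetric])
    qed (simp add: r0 F_zero)
  qed
  moreover have "u * f ^ m = poly r f" by (simp add: r_def poly_monom)
  ultimately show ?thesis using filtration_integral[OF max] by blast
qed

end

section \<open>Subrings over which the ring is generated by one element\<close>

context prime_ideal_set
begin

text \<open>Here \<open>S\<close> is step 0 of a maximal filtration, which is exhaustive because
  everything is algebraic over \<open>A\<close>. Both \<open>p\<close> and \<open>p * r - 1\<close>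
  lie in step 1, so their powers absorb any negative index.\<close>

lemma subring_generating_over:
  assumes "valued_subring P A0 v0" "p \<in> A0" "1 \<le> v0 p" "p * r - 1 \<in> A0" "1 \<le> v0 (p * r - 1)"
  obtains S where "is_subring S" "P \<subseteq> S" "r \<notin> S"
    "\<And>T f. is_subring T \<Longrightarrow> S \<subseteq> T \<Longrightarrow> r \<in> T \<Longrightarrow> f \<in> T"
proof -
  obtain A v where Av: "valued_subring P A v" "A0 \<subseteq> A" "\<And>a. a \<in> A0 \<Longrightarrow> v a = v0 a"
    "\<And>y. \<not> transcendental_mod P A y" 
    using maximal_valued_subring[OF assms(1), of thesis] by simp
  interpret valued_subring P A v by (rule Av(1))
  obtain F where F: "filtration F" and max: "\<And>F'. filtration F' \<Longrightarrow> F \<subseteq> F' \<Longrightarrow> F' = F"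
    using maximal_filtration by blast
  interpret filtered_ring P A v F by unfold_locales (rule F)
  have exhaust: "\<exists>n. (f, n) \<in> F" for f by (rule filtration_exhaustive[OF max Av(4)])
  define x where "x = p * r"
  have p: "(p, 1) \<in> F" and x1: "(x - 1, 1) \<in> F"
    using F_A[of p 1 1] F_A[of "x - 1" 1 1] assms(2-5) Av(2,3) unfolding x_def
    by (auto simp: one_enat_def)
  have one: "(1, 1) \<notin> F" using F_proper[OF A_closed(1), of 0] v_one by (simp add: zero_enat_def)
  define S where "S = {f. (f, 0) \<in> F}"
  have xS: "x \<in> S" "1 - x \<in> S"
    using F_add[OF F_mono[OF x1] F_one, of 0] F_neg[OF F_mono[OF x1, of 0]] by (auto simp: S_def)
  \<comment> \<open>With \<open>r\<close> in step 0, the product \<open>x = p * r\<close> would lie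
    in step 1 together with \<open>x - 1\<close>, and hence so would 1.\<close>
  have r: "r \<notin> S"
  proof
    assume "r \<in> S"
    then have "(x, 1) \<in> F" using F_mult[OF p, of r 0] by (simp add: S_def x_def)
    then have "(1, 1) \<in> F" using F_diff[OF _ x1] by fastforce
    then show False using one by blast
  qed
  have "f \<in> T" if T: "is_subring T" "S \<subseteq> T" "r \<in> T" for T f
  proof -
    obtain n where n: "(f, n) \<in> F" using exhaust by blast
    define N where "N = nat (- n)"
    have small: "p ^ k * f \<in> S" "(1 - x) ^ k * f \<in> S" if "k \<ge> N" for k
    proof -
      have "(1 - x, 1) \<in> F" using F_neg[OF x1] by simp
      then show "p ^ k * f \<in> S" "(1 - x) ^ k * f \<in> S"
        using F_mono[OF F_mult[OF F_power[OF p] n, of k], of 0]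
          F_mono[OF F_mult[OF F_power n, of "1 - x" 1 k], of 0] that
        by (auto simp: S_def N_def)
    qed
    \<comment> \<open>This is the binomial expansion of a power of \<open>x + (1 - x)\<close>, done
      one factor at a time until an exponent reaches \<open>N\<close>. While both exponents are
      below \<open>N\<close>, their sum is below \<open>2 * N\<close>, so the truncated difference
      strictly decreases.\<close>
    have "x ^ a * (1 - x) ^ b * f \<in> T" if "2 * N - (a + b) = k" for a b k
      using that
    proof (induction k arbitrary: a b rule: less_induct)
      case (less k)
      consider "a \<ge> N" | "b \<ge> N" | "a < N" "b < N" by linarith
      then show ?case
      proof cases
        case 1
        have "x ^ a * (1 - x) ^ b * f = (1 - x) ^ b * (p ^ a * f) * r ^ a"
          unfolding x_def by (simp add: power_mult_distrib ac_simps)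
        also have "\<dots> \<in> T"
          by (intro is_subringD(5)[OF T(1) is_subringD(5)[OF T(1)]] is_subringD(7)[OF T(1)] T(3) subsetD[OF T(2) xS(2)] subsetD[OF T(2) small(1)[OF 1]])
        finally show ?thesis .
      next
        case 2
        have "x ^ a * (1 - x) ^ b * f = x ^ a * ((1 - x) ^ b * f)" by (simp add: ac_simps)
        also have "\<dots> \<in> T"
          by (intro is_subringD(5)[OF T(1) is_subringD(7)[OF T(1)]] subsetD[OF T(2) xS(1)] subsetD[OF T(2) small(2)[OF 2]])
        finally show ?thesis .
      next
        case 3
        have "x ^ a * (1 - x) ^ b * f = x ^ Suc a * (1 - x) ^ b * f + x ^ a * (1 - x) ^ Suc b * f"
          by (simp add: algebra_simps)
        also have "\<dots> \<in> T"
          using 3 less.prems by (intro is_subringD(4)[OF T(1)] less.IH[OF _ refl]) auto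
        finally show ?thesis .
      qed
    qed
    from this[of 0 0] show ?thesis by simp
  qed
  moreover have "is_subring S"
    unfolding is_subring_def S_def using F_one F_diff F_mult[of _ 0 _ 0] by auto
  moreover have "P \<subseteq> S" using F_P by (auto simp: S_def)
  ultimately show ?thesis using r that by blast
qed

text \<open>Used for the substitutions that pass between \<open>x - 1\<close> and \<open>x\<close>.
  Only sums and integer multiples occur, so one argument covers both a subring and the ideal
  \<open>P\<close>.\<close>

lemma coeff_pcompose_linear_mem:
  assumes "is_subring B \<or> B = P" "\<And>i. coeff q i \<in> B"
  shows "coeff (pcompose q [:of_int c, 1:]) i \<in> B"
  using assms(2)
proof (induction q arbitrary: i)
  case 0
  then show ?case using assms(1) is_subringD(2) by auto
next
  case (pCons a q)
  note B = assms(1)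
  have closed: "0 \<in> B" "x \<in> B \<Longrightarrow> y \<in> B \<Longrightarrow> x + y \<in> B" for x y
    using B P_zero P_add is_subringD(2,4) by auto
  have int: "of_int k * x \<in> B" if "x \<in> B" for k x
  proof -
    have neg: "- y \<in> B" if "y \<in> B" for y using B P_neg is_subringD(6) that by auto
    have nat: "of_nat n * x \<in> B" for n
      using closed \<open>x \<in> B\<close> by (induction n) (auto simp: distrib_right)
    show ?thesis using nat[of "nat k"] neg[OF nat[of "nat (- k)"]] by (cases "k \<ge> 0") auto
  qed
  have q: "coeff q j \<in> B" for j using pCons.prems[of "Suc j"] by simp
  have a: "a \<in> B" using pCons.prems[of 0] by simp
  have r: "coeff (pcompose q [:of_int c, 1:]) j \<in> B" for j by (rule pCons.IH[OF q])
  show ?case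
    using a r closed int by (auto simp: pcompose_pCons coeff_pCons split: nat.split)
qed

lemma poly_eq_coeff_0_plus:
  "\<exists>g. poly q y = coeff q 0 + y * g" for q :: "'a poly"
  by (cases q) auto

text \<open>An algebraic element that is divisible by all primes forces some prime to be invertible:
  dividing a relation by a power of the element puts a nonzero integer in the ideal that it generates.\<close>

lemma exists_valued_subring:
  assumes int: "\<And>k::int. k \<noteq> 0 \<Longrightarrow> of_int k \<notin> P" and z: "z \<notin> P"
    and div: "\<And>p::nat. prime p \<Longrightarrow> \<exists>r. z - of_nat p * r \<in> P"
  obtains A v and p :: nat and r where "valued_subring P A v" "of_nat p \<in> A" "v (of_nat p) = 1"
    "of_nat p * r - 1 \<in> A" "1 \<le> v (of_nat p * r - 1)"
proof -
  define B where "B = {of_int k + b |k b. b \<in> P}"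
  have p_B: "of_nat p \<in> B" for p
    unfolding B_def using P_zero by (intro CollectI exI[of _ "int p"] exI[of _ 0]) auto
  obtain r2 where "z - of_nat 2 * r2 \<in> P" using div[OF two_is_prime_nat] by blast
  then have r2: "z - 2 * r2 \<in> P" by simp
  show ?thesis
  \<comment> \<open>Modulo \<open>P\<close> the element \<open>2 * r2\<close> is \<open>z\<close>.
    In the transcendental case the 2-adic valuation is extended with value 1 at
    \<open>2 * r2 - 1\<close>.\<close>
  proof (cases "transcendental_mod P B (2 * r2 - 1)")
    case True
    obtain A v where A: "valued_subring P A v" "A = {of_int k + b |k b. b \<in> P}" "v (of_nat 2) = 1"
      by (rule valued_subring_integers[OF int two_is_prime_nat])
    have AB: "A = B" unfolding A(2) B_def ..
    interpret valued_subring P A v by (rule A(1))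
    show ?thesis
    proof (rule valued_subring_gauss_extension)
      show "transcendental_mod P A (2 * r2 - 1)" using True unfolding AB .
    next
      fix A' v'
      assume A': "valued_subring P A' v'" "A \<subseteq> A'" "2 * r2 - 1 \<in> A'"
        "\<And>a. a \<in> A \<Longrightarrow> v' a = v a" "v' (2 * r2 - 1) = enat 1"
      have 2: "of_nat 2 \<in> A" unfolding AB by (rule p_B)
      show thesis
      proof (rule that[of A' v' 2 r2])
        show "valued_subring P A' v'" by (rule A'(1))
        show "of_nat 2 \<in> A'" "v' (of_nat 2) = 1" using 2 A'(2,4) A(3) by auto
        show "of_nat 2 * r2 - 1 \<in> A'" "1 \<le> v' (of_nat 2 * r2 - 1)"
          using A'(3,5) by (auto simp: one_enat_def)
      qed
    qed
  next
    case False
    obtain A2 v2 where A2: "valued_subring P A2 v2" "A2 = {of_int k + b |k b. b \<in> P}"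
      by (rule valued_subring_integers[OF int two_is_prime_nat])
    have "A2 = B" unfolding A2(2) B_def ..
    with A2(1) have B: "is_subring B" using valued_subring.A_subring by blast
    define x where "x = 2 * r2"
    obtain q0 j where q0: "\<And>i. coeff q0 i \<in> B" "poly q0 (x - 1) \<in> P" "coeff q0 j \<notin> P"
      using False unfolding transcendental_mod_def x_def by blast
    \<comment> \<open>The relation for \<open>x - 1\<close> becomes one for \<open>x\<close>;
      undoing the substitution shows that some coefficient stays outside \<open>P\<close>.\<close>
    define q where "q = pcompose q0 [:of_int (- 1), 1:]"
    have qB: "coeff q i \<in> B" for i
      unfolding q_def using B q0(1) by (intro coeff_pcompose_linear_mem) auto
    have "poly q x \<in> P" using q0(2) unfolding q_def by (simp add: poly_pcompose)
    have "\<exists>i. coeff q i \<notin> P"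
    proof (rule ccontr)
      assume "\<not> ?thesis"
      then have "coeff (pcompose q [:of_int 1, 1:]) j \<in> P" by (intro coeff_pcompose_linear_mem) auto
      moreover have "pcompose q [:of_int 1, 1:] = q0"
      proof -
        have "pcompose [:of_int (- 1), 1:] [:of_int 1, 1:] = ([:0, 1:] :: 'a poly)"
          by (simp add: pcompose_pCons)
        then show ?thesis unfolding q_def by (metis pcompose_assoc pcompose_idR)
      qed
      ultimately show False using q0(3) by simp
    qed
    then obtain i0 where i0: "coeff q i0 \<notin> P" by blast
    \<comment> \<open>Since \<open>x\<close> is not in \<open>P\<close>, the power
      \<open>x ^ m\<close> can be cancelled. The relation then has a constant term outside
      \<open>P\<close>, which is a nonzero integer \<open>c\<close> modulo \<open>P\<close>.\<close>
    define m where "m = (LEAST i. coeff q i \<notin> P)"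
    have m: "coeff q m \<notin> P" unfolding m_def by (rule LeastI[of "\<lambda>i. coeff q i \<notin> P", OF i0])
    have m_min: "coeff q i \<in> P" if "i < m" for i using not_less_Least[of i] that unfolding m_def by blast
    define q1 where "q1 = poly_shift m q"
    have x: "x \<notin> P" using z r2 P_cong[of z x] unfolding x_def by blast
    have "poly (q - monom 1 m * q1) x \<in> P"
      by (rule poly_mem_P) (auto simp: q1_def coeff_monom_mult coeff_poly_shift m_min P_zero)
    then have "poly q x - x ^ m * poly q1 x \<in> P" by (simp add: poly_monom)
    then have "x ^ m * poly q1 x \<in> P" using \<open>poly q x \<in> P\<close> P_cong by blast
    then have "poly q1 x \<in> P" using P_prime P_power x by blast
    moreover obtain g where "poly q1 x = coeff q1 0 + x * g" using poly_eq_coeff_0_plus by blast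
    ultimately have g: "coeff q m + x * g \<in> P" by (simp add: q1_def coeff_poly_shift)
    obtain c b where c: "coeff q m = of_int c + b" "b \<in> P" using qB unfolding B_def by blast
    have "c \<noteq> 0" using c m by auto
    have cg: "of_int c + x * g \<in> P" using P_diff[OF g c(2)] c(1) by (simp add: algebra_simps)
    obtain p where p: "prime p" "p > nat \<bar>c\<bar>" using bigger_prime by blast
    have "\<not> int p dvd c"
      using zdvd_imp_le[of "int p" "\<bar>c\<bar>"] p(2) \<open>c \<noteq> 0\<close> by auto
    then have "coprime (int p) c" using p(1) by (simp add: prime_imp_coprime prime_int_nat_transfer)
    then obtain s t where st: "s * int p + t * c = 1"
      using bezout_int[of "int p" c] by (auto simp: coprime_iff_gcd_eq_1)
    obtain rp where rp: "z - of_nat p * rp \<in> P" using div[OF p(1)] by blast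
    \<comment> \<open>Modulo \<open>P\<close>, \<open>c = - x * g\<close> and
      \<open>x = p * rp\<close>, so the Bezout identity reads
      \<open>1 = p * (s - t * rp * g)\<close>.\<close>
    define r where "r = of_int s - of_int t * rp * g"
    have "of_nat p * r - 1 \<in> P"
    proof -
      have "of_int (s * int p + t * c) = (1 :: 'a)" unfolding st by simp
      then have one: "of_int s * of_nat p + of_int t * of_int c = (1 :: 'a)" by simp
      have "x - of_nat p * rp \<in> P" using P_diff[OF rp r2] by (simp add: x_def)
      then have "(x - of_nat p * rp) * (of_int t * g) - (of_int c + x * g) * of_int t \<in> P"
        by (rule P_diff[OF P_mult P_mult[OF cg]])
      also have "(x - of_nat p * rp) * (of_int t * g) - (of_int c + x * g) * of_int t
        = of_nat p * r - (of_int s * of_nat p + of_int t * of_int c)"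
        by (simp add: r_def algebra_simps)
      finally show ?thesis unfolding one .
    qed
    note pr = this
    obtain A v where A: "valued_subring P A v" "A = {of_int k + b |k b. b \<in> P}"
      "v (of_nat p) = 1" by (rule valued_subring_integers[OF int p(1)])
    have AB: "A = B" unfolding A(2) B_def ..
    have prA: "of_nat p * r - 1 \<in> A" using pr valued_subring.P_subset_A[OF A(1)] by blast
    show ?thesis
    proof (rule that[of A v p r])
      show "of_nat p \<in> A" unfolding AB by (rule p_B)
      show "1 \<le> v (of_nat p * r - 1)" using valued_subring.v_infinity[OF A(1) prA] pr by simp
    qed (fact A prA)+
  qed
qed

end

section \<open>Zorn arguments for subrings and for prime ideals\<close>

lemma maximal_avoiding_subring:
  assumes "is_subring S" "r \<notin> S"
    and gen: "\<And>T f. is_subring T \<Longrightarrow> S \<subseteq> T \<Longrightarrow> r \<in> T \<Longrightarrow> f \<in> T"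
  obtains M where "is_subring M" "S \<subseteq> M" "M \<noteq> UNIV" "\<And>T. is_subring T \<Longrightarrow> M \<subset> T \<Longrightarrow> T = UNIV"
proof -
  define Z where "Z = {T. is_subring T \<and> S \<subseteq> T \<and> r \<notin> T}"
  have "\<exists>M\<in>Z. \<forall>X\<in>Z. M \<subseteq> X \<longrightarrow> X = M"
  proof (rule subset_Zorn_nonempty)
    show "Z \<noteq> {}" using assms(1,2) by (auto simp: Z_def)
    fix \<C> assume ne: "\<C> \<noteq> {}" and ch: "subset.chain Z \<C>"
    have sub: "is_subring C" "S \<subseteq> C" "r \<notin> C" if "C \<in> \<C>" for C
      using that ch unfolding subset.chain_def Z_def by auto
    have "is_subring (\<Union>\<C>)"
      unfolding is_subring_def
    proof (intro conjI ballI)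
      obtain C1 where "C1 \<in> \<C>" using ne by blast
      then show "1 \<in> \<Union>\<C>" using is_subringD(1)[OF sub(1)] by blast
      fix a b assume "a \<in> \<Union>\<C>" "b \<in> \<Union>\<C>"
      then obtain C where C: "C \<in> \<C>" "a \<in> C" "b \<in> C" by (rule chain_Union_common[OF ch])
      then show "a - b \<in> \<Union>\<C>" "a * b \<in> \<Union>\<C>" using is_subringD(3,5)[OF sub(1)[OF C(1)]] by blast+
    qed
    moreover obtain C1 where "C1 \<in> \<C>" using ne by blast
    ultimately show "\<Union>\<C> \<in> Z" using sub(2)[of C1] sub(3) by (auto simp: Z_def)
  qed
  then obtain M where M: "M \<in> Z" "\<And>X. X \<in> Z \<Longrightarrow> M \<subseteq> X \<Longrightarrow> X = M" by blast
  show ?thesis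
  proof
    show "is_subring M" "S \<subseteq> M" "M \<noteq> UNIV" using M(1) by (auto simp: Z_def)
    show "T = UNIV" if T: "is_subring T" "M \<subset> T" for T
    proof -
      have "S \<subseteq> T" using \<open>S \<subseteq> M\<close> T(2) by blast
      \<comment> \<open>A subring strictly above \<open>M\<close> cannot omit \<open>r\<close>,
        since \<open>M\<close> is maximal with that property.\<close>
      moreover have "r \<in> T" using M(2)[of T] T \<open>S \<subseteq> T\<close> by (auto simp: Z_def)
      ultimately show ?thesis using gen T(1) by blast
    qed
  qed
qed

definition is_ideal :: "'b::comm_ring_1 set \<Rightarrow> bool" where
  "is_ideal I \<longleftrightarrow> 0 \<in> I \<and> (\<forall>a\<in>I. \<forall>b\<in>I. a - b \<in> I) \<and> (\<forall>a\<in>I. \<forall>b. a * b \<in> I)"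

text \<open>An ideal maximal among those above \<open>I\<close> without powers of \<open>z\<close>
  is prime: if \<open>a\<close> and \<open>b\<close> were outside it, adjoining either would catch a
  power of \<open>z\<close>, and the product of these two powers would lie in the ideal once
  \<open>a * b\<close> does. The exponent 0 makes the ideal proper.\<close>

lemma exists_prime_ideal_avoiding_powers:
  assumes I: "is_ideal I" and z: "\<And>n. z ^ n \<notin> I"
  obtains P where "prime_ideal_set P" "I \<subseteq> P" "z \<notin> P"
proof -
  define Z where "Z = {J. is_ideal J \<and> I \<subseteq> J \<and> (\<forall>n. z ^ n \<notin> J)}"
  have "\<exists>M\<in>Z. \<forall>X\<in>Z. M \<subseteq> X \<longrightarrow> X = M"
  proof (rule subset_Zorn_nonempty)
    show "Z \<noteq> {}" using assms by (auto simp: Z_def)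
    fix \<C> assume ne: "\<C> \<noteq> {}" and ch: "subset.chain Z \<C>"
    have sub: "is_ideal C" "I \<subseteq> C" "\<forall>n. z ^ n \<notin> C" if "C \<in> \<C>" for C
      using that ch unfolding subset.chain_def Z_def by auto
    have "is_ideal (\<Union>\<C>)"
      unfolding is_ideal_def
    proof (intro conjI ballI allI)
      obtain C1 where "C1 \<in> \<C>" using ne by blast
      then show "0 \<in> \<Union>\<C>" using sub(1)[of C1] unfolding is_ideal_def by blast
    next
      fix a b assume "a \<in> \<Union>\<C>"
      then obtain C where "C \<in> \<C>" "a \<in> C" by blast
      then show "a * b \<in> \<Union>\<C>" using sub(1)[of C] unfolding is_ideal_def by blast
    next
      fix a b assume "a \<in> \<Union>\<C>" "b \<in> \<Union>\<C>"
      then obtain C where C: "C \<in> \<C>" "a \<in> C" "b \<in> C" by (rule chain_Union_common[OF ch])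
      then show "a - b \<in> \<Union>\<C>" using sub(1)[OF C(1)] unfolding is_ideal_def by blast
    qed
    moreover obtain C1 where "C1 \<in> \<C>" using ne by blast
    ultimately show "\<Union>\<C> \<in> Z" using sub(2)[of C1] sub(3) by (auto simp: Z_def)
  qed
  then obtain P where P: "P \<in> Z" "\<And>X. X \<in> Z \<Longrightarrow> P \<subseteq> X \<Longrightarrow> X = P" by blast
  have zero: "0 \<in> P" and diff: "\<And>a b. a \<in> P \<Longrightarrow> b \<in> P \<Longrightarrow> a - b \<in> P"
    and mult: "\<And>a b. a \<in> P \<Longrightarrow> a * b \<in> P" and IP: "I \<subseteq> P" and zP: "\<And>n. z ^ n \<notin> P"
    using P(1) unfolding Z_def is_ideal_def by auto
  have add: "a + b \<in> P" if "a \<in> P" "b \<in> P" for a b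
    using diff[OF that(1) diff[OF zero that(2)]] by simp
  have adjoin: "\<exists>n b. z ^ n - a * b \<in> P" if "a \<notin> P" for a
  proof (rule ccontr)
    assume no: "\<not> ?thesis"
    define J where "J = {c. \<exists>b. c - a * b \<in> P}"
    have "is_ideal J"
      unfolding is_ideal_def J_def
    proof (intro conjI ballI allI; clarsimp)
      show "\<exists>b. - (a * b) \<in> P" using zero by (intro exI[of _ 0]) simp
      show "\<exists>b. x - y - a * b \<in> P" if "x - a * s \<in> P" "y - a * t \<in> P" for x y s t
        using diff[OF that] by (intro exI[of _ "s - t"]) (simp add: algebra_simps)
      show "\<exists>b. x * y - a * b \<in> P" if "x - a * s \<in> P" for x y s
        using mult[OF that, of y] by (intro exI[of _ "s * y"]) (simp add: algebra_simps)
    qed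
    moreover have "P \<subseteq> J" unfolding J_def by (auto intro: exI[of _ 0])
    moreover have "z ^ n \<notin> J" for n using no unfolding J_def by blast
    ultimately have "J = P" using P(2)[of J] IP unfolding Z_def by blast
    moreover have "a \<in> J" unfolding J_def using zero by (auto intro: exI[of _ 1])
    ultimately show False using that by blast
  qed
  have "prime_ideal_set P"
  proof
    show "1 \<notin> P" using zP[of 0] by simp
    show "a \<in> P \<or> b \<in> P" if ab: "a * b \<in> P" for a b
    proof (rule ccontr)
      assume "\<not> ?thesis"
      then obtain m s n t where st: "z ^ m - a * s \<in> P" "z ^ n - b * t \<in> P" using adjoin by blast
      have "(z ^ m - a * s) * z ^ n + (z ^ n - b * t) * (a * s) + a * b * (s * t) \<in> P"
        by (intro add mult st ab)
      also have "(z ^ m - a * s) * z ^ n + (z ^ n - b * t) * (a * s) + a * b * (s * t) = z ^ (m + n)"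
        by (simp add: algebra_simps power_add)
      finally show False using zP by blast
    qed
  qed (fact zero diff mult)+
  then show ?thesis using that IP zP[of 1] by simp
qed

lemma exists_maximal_subring_above_ideal:
  fixes I :: "'b::comm_ring_1 set"
  assumes I: "is_ideal I" and z: "\<And>n. z ^ n \<notin> I"
    and div: "\<And>p::nat. prime p \<Longrightarrow> \<exists>r. z - of_nat p * r \<in> I"
  obtains M where "is_subring M" "I \<subseteq> M" "M \<noteq> UNIV" "\<And>T. is_subring T \<Longrightarrow> M \<subset> T \<Longrightarrow> T = UNIV"
proof -
  obtain P where P: "prime_ideal_set P" "I \<subseteq> P" "z \<notin> P"
    by (rule exists_prime_ideal_avoiding_powers[OF I z])
  interpret prime_ideal_set P by (rule P(1))
  have nat: "of_nat n \<notin> P" if "n > 0" for n :: nat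
    using that
  proof (induction n rule: less_induct)
    case (less n)
    show ?case
    proof (cases "n = 1")
      case True
      then show ?thesis using P_one by simp
    next
      case False
      then obtain p where p: "prime p" "p dvd n" using prime_factor_nat by blast
      then obtain k where k: "n = p * k" by blast
      \<comment> \<open>As \<open>z\<close> is a multiple of \<open>p\<close> modulo
        \<open>P\<close>, a prime number in \<open>P\<close> would force \<open>z\<close> into
        \<open>P\<close>.\<close>
      have "of_nat p \<notin> P"
      proof
        assume *: "of_nat p \<in> P"
        obtain r where "z - of_nat p * r \<in> P" using div[OF p(1)] P(2) by blast
        from P_add[OF this P_mult[OF *, of r]] show False using P(3) by simp
      qed
      moreover have "of_nat k \<notin> P"
        using less.IH[of k] less.prems k prime_gt_1_nat[OF p(1)] by simp
      ultimately show ?thesis using P_prime unfolding k of_nat_mult by blast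
    qed
  qed
  have int: "of_int k \<notin> P" if "k \<noteq> 0" for k :: int
  proof (cases "k > 0")
    case True
    then show ?thesis using nat[of "nat k"] by simp
  next
    case False
    then have "of_int (- k) \<notin> P" using nat[of "nat (- k)"] that by simp
    then show ?thesis using P_neg[of "of_int k"] by auto
  qed
  have div': "\<exists>r. z - of_nat p * r \<in> P" if "prime p" for p :: nat using div[OF that] P(2) by blast
  obtain A v and p :: nat and r where A: "valued_subring P A v" "of_nat p \<in> A" "v (of_nat p) = 1"
    "of_nat p * r - 1 \<in> A" "1 \<le> v (of_nat p * r - 1)"
    by (rule exists_valued_subring[OF int P(3) div'])
  have "1 \<le> v (of_nat p)" using A(3) by simp
  show ?thesis
  proof (rule subring_generating_over[OF A(1,2) \<open>1 \<le> v (of_nat p)\<close> A(4,5)])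
    fix S
    assume S: "is_subring S" "P \<subseteq> S" "r \<notin> S"
      "\<And>T f. is_subring T \<Longrightarrow> S \<subseteq> T \<Longrightarrow> r \<in> T \<Longrightarrow> f \<in> T"
    show thesis
    proof (rule maximal_avoiding_subring[OF S(1,3,4)])
      fix M
      assume M: "is_subring M" "S \<subseteq> M" "M \<noteq> UNIV"
        "\<And>T. is_subring T \<Longrightarrow> M \<subset> T \<Longrightarrow> T = UNIV"
      have "I \<subseteq> M" using P(2) S(2) M(2) by blast
      then show thesis using M by (intro that)
    qed
  qed
qed

section \<open>Presenting a ring as a quotient of a free commutative ring\<close>

datatype 'a ring_term =
  Gen 'a | Zero | One | Add "'a ring_term" "'a ring_term"
  | Mul "'a ring_term" "'a ring_term" | Neg "'a ring_term"

inductive ring_eq :: "'a ring_term \<Rightarrow> 'a ring_term \<Rightarrow> bool" where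
  refl: "ring_eq s s"
| sym: "ring_eq s t \<Longrightarrow> ring_eq t s"
| trans: "ring_eq s t \<Longrightarrow> ring_eq t u \<Longrightarrow> ring_eq s u"
| add_cong: "ring_eq s s' \<Longrightarrow> ring_eq t t' \<Longrightarrow> ring_eq (Add s t) (Add s' t')"
| mul_cong: "ring_eq s s' \<Longrightarrow> ring_eq t t' \<Longrightarrow> ring_eq (Mul s t) (Mul s' t')"
| neg_cong: "ring_eq s s' \<Longrightarrow> ring_eq (Neg s) (Neg s')"
| add_assoc: "ring_eq (Add (Add s t) u) (Add s (Add t u))"
| add_comm: "ring_eq (Add s t) (Add t s)"
| add_zero: "ring_eq (Add Zero s) s"
| add_neg: "ring_eq (Add (Neg s) s) Zero"
| mul_assoc: "ring_eq (Mul (Mul s t) u) (Mul s (Mul t u))"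
| mul_comm: "ring_eq (Mul s t) (Mul t s)"
| mul_one: "ring_eq (Mul One s) s"
| distrib: "ring_eq (Mul (Add s t) u) (Add (Mul s u) (Mul t u))"

text \<open>The homomorphism to the integers that kills all generators; it separates
  \<open>Zero\<close> from \<open>One\<close> and so shows that the quotient is nontrivial.\<close>

primrec int_eval :: "'a ring_term \<Rightarrow> int" where
  "int_eval (Gen x) = 0"
| "int_eval Zero = 0"
| "int_eval One = 1"
| "int_eval (Add s t) = int_eval s + int_eval t"
| "int_eval (Mul s t) = int_eval s * int_eval t"
| "int_eval (Neg s) = - int_eval s"

lemma int_eval_cong: "ring_eq s t \<Longrightarrow> int_eval s = int_eval t"
  by (induction rule: ring_eq.induct) (auto simp: algebra_simps)

quotient_type 'a free_ring = "'a ring_term" / ring_eq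
  by (intro equivpI reflpI sympI transpI)
    (auto intro: ring_eq.refl ring_eq.sym ring_eq.trans)

instantiation free_ring :: (type) comm_ring_1
begin

lift_definition zero_free_ring :: "'a free_ring" is Zero .
lift_definition one_free_ring :: "'a free_ring" is One .
lift_definition plus_free_ring :: "'a free_ring \<Rightarrow> 'a free_ring \<Rightarrow> 'a free_ring" is Add
  by (rule ring_eq.add_cong)
lift_definition times_free_ring :: "'a free_ring \<Rightarrow> 'a free_ring \<Rightarrow> 'a free_ring" is Mul
  by (rule ring_eq.mul_cong)
lift_definition uminus_free_ring :: "'a free_ring \<Rightarrow> 'a free_ring" is Neg
  by (rule ring_eq.neg_cong)
lift_definition minus_free_ring :: "'a free_ring \<Rightarrow> 'a free_ring \<Rightarrow> 'a free_ring" is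
  "\<lambda>s t. Add s (Neg t)"
  by (intro ring_eq.add_cong ring_eq.neg_cong)

instance
proof
  fix a b c :: "'a free_ring"
  show "a + b + c = a + (b + c)" by transfer (rule ring_eq.add_assoc)
  show "a + b = b + a" by transfer (rule ring_eq.add_comm)
  show "0 + a = a" by transfer (rule ring_eq.add_zero)
  show "- a + a = 0" by transfer (rule ring_eq.add_neg)
  show "a - b = a + - b" by transfer (rule ring_eq.refl)
  show "a * b * c = a * (b * c)" by transfer (rule ring_eq.mul_assoc)
  show "a * b = b * a" by transfer (rule ring_eq.mul_comm)
  show "1 * a = a" by transfer (rule ring_eq.mul_one)
  show "(a + b) * c = a * c + b * c" by transfer (rule ring_eq.distrib)
  show "(0 :: 'a free_ring) \<noteq> 1" by transfer (auto dest: int_eval_cong)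
qed

end

text \<open>Generators range over the whole type, so those outside the carrier are sent to zero;
  every term then has its value in the carrier.\<close>

primrec ring_eval :: "('a, 'm) ring_scheme \<Rightarrow> 'a ring_term \<Rightarrow> 'a" where
  "ring_eval R (Gen x) = (if x \<in> carrier R then x else \<zero>\<^bsub>R\<^esub>)"
| "ring_eval R Zero = \<zero>\<^bsub>R\<^esub>"
| "ring_eval R One = \<one>\<^bsub>R\<^esub>"
| "ring_eval R (Add s t) = ring_eval R s \<oplus>\<^bsub>R\<^esub> ring_eval R t"
| "ring_eval R (Mul s t) = ring_eval R s \<otimes>\<^bsub>R\<^esub> ring_eval R t"
| "ring_eval R (Neg s) = \<ominus>\<^bsub>R\<^esub> ring_eval R s"

definition free_ring_hom :: "('a, 'm) ring_scheme \<Rightarrow> 'a free_ring \<Rightarrow> 'a" where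
  "free_ring_hom R a = ring_eval R (rep_free_ring a)"

section \<open>The evaluation map onto \<open>R\<close> and the transfer of maximal subrings\<close>

context cring
begin

lemma ring_eval_closed: "ring_eval R s \<in> carrier R"
  by (induction s) auto

lemma ring_eval_cong: "ring_eq s t \<Longrightarrow> ring_eval R s = ring_eval R t"
  by (induction rule: ring_eq.induct)
    (auto simp: ring_eval_closed a_ac m_ac l_distr r_distr l_neg r_neg)

text \<open>\<open>ring_eval\<close> is constant on classes, so the representative picked by
  \<open>rep_free_ring\<close> is immaterial.\<close>

lemma free_ring_hom_abs: "free_ring_hom R (abs_free_ring s) = ring_eval R s"
proof -
  have "ring_eq (rep_free_ring (abs_free_ring s)) s"
    by (rule Quotient3_rep_abs[OF Quotient3_free_ring]) (rule ring_eq.refl)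
  then show ?thesis unfolding free_ring_hom_def by (rule ring_eval_cong)
qed

lemma free_ring_hom_closed: "free_ring_hom R a \<in> carrier R"
  unfolding free_ring_hom_def by (rule ring_eval_closed)

lemma free_ring_hom_surj: "x \<in> carrier R \<Longrightarrow> \<exists>a. free_ring_hom R a = x"
  using free_ring_hom_abs[of "Gen x"] by auto

lemma free_ring_hom_simps:
  "free_ring_hom R 0 = \<zero>"
  "free_ring_hom R 1 = \<one>"
  "free_ring_hom R (a + b) = free_ring_hom R a \<oplus> free_ring_hom R b"
  "free_ring_hom R (a * b) = free_ring_hom R a \<otimes> free_ring_hom R b"
  "free_ring_hom R (- a) = \<ominus> free_ring_hom R a"
  "free_ring_hom R (a - b) = free_ring_hom R a \<ominus> free_ring_hom R b"
proof -
  show "free_ring_hom R 0 = \<zero>" "free_ring_hom R 1 = \<one>"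
    by (simp_all add: zero_free_ring.abs_eq one_free_ring.abs_eq free_ring_hom_abs)
  show add: "free_ring_hom R (a + b) = free_ring_hom R a \<oplus> free_ring_hom R b" for a b
    by (induction a rule: free_ring.abs_induct; induction b rule: free_ring.abs_induct)
      (simp add: plus_free_ring.abs_eq free_ring_hom_abs)
  show "free_ring_hom R (a * b) = free_ring_hom R a \<otimes> free_ring_hom R b"
    by (induction a rule: free_ring.abs_induct; induction b rule: free_ring.abs_induct)
      (simp add: times_free_ring.abs_eq free_ring_hom_abs)
  show neg: "free_ring_hom R (- a) = \<ominus> free_ring_hom R a" for a
    by (induction a rule: free_ring.abs_induct) (simp add: uminus_free_ring.abs_eq free_ring_hom_abs)
  show "free_ring_hom R (a - b) = free_ring_hom R a \<ominus> free_ring_hom R b"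
    unfolding a_minus_def neg[symmetric] add[symmetric] by simp
qed

lemma free_ring_hom_power: "free_ring_hom R (a ^ n) = free_ring_hom R a [^] n" for n :: nat
  by (induction n) (auto simp: free_ring_hom_simps free_ring_hom_closed m_comm)

lemma free_ring_hom_of_nat: "free_ring_hom R (of_nat n) = [n] \<cdot> \<one>" for n :: nat
  by (induction n) (auto simp: free_ring_hom_simps add.nat_pow_Suc a_comm)

lemma subring_image:
  assumes "is_subring M"
  shows "subring (free_ring_hom R ` M) R"
proof (rule subringI)
  note M = is_subringD[OF assms]
  let ?h = "free_ring_hom R"
  show "?h ` M \<subseteq> carrier R" using free_ring_hom_closed by blast
  show "\<one> \<in> ?h ` M" using imageI[OF M(1), of ?h] by (simp add: free_ring_hom_simps)
  fix x assume "x \<in> ?h ` M"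
  then obtain a where a: "a \<in> M" "x = ?h a" by blast
  show "\<ominus> x \<in> ?h ` M" using imageI[OF M(6)[OF a(1)], of ?h] by (simp add: free_ring_hom_simps a)
  fix y assume "y \<in> ?h ` M"
  then obtain b where b: "b \<in> M" "y = ?h b" by blast
  show "x \<otimes> y \<in> ?h ` M" using imageI[OF M(5)[OF a(1) b(1)], of ?h] by (simp add: free_ring_hom_simps a b)
  show "x \<oplus> y \<in> ?h ` M" using imageI[OF M(4)[OF a(1) b(1)], of ?h] by (simp add: free_ring_hom_simps a b)
qed

lemma is_subring_vimage:
  assumes "subring T R"
  shows "is_subring (free_ring_hom R -` T)"
  using subringE[OF assms]
  unfolding is_subring_def by (auto simp: free_ring_hom_simps a_minus_def)

text \<open>Correspondence of subrings: since \<open>M\<close> contains the kernel, it is the full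
  preimage of its image, and the preimage of a subring strictly above the image is strictly above
  \<open>M\<close>.\<close>

lemma maximal_subring_image:
  assumes M: "is_subring M" "free_ring_hom R -` {\<zero>} \<subseteq> M" "M \<noteq> UNIV"
    and max: "\<And>T. is_subring T \<Longrightarrow> M \<subset> T \<Longrightarrow> T = UNIV"
  shows "maximal_subring (free_ring_hom R ` M) R"
proof -
  let ?h = "free_ring_hom R"
  have mem: "a \<in> M" if a: "?h a \<in> ?h ` M" for a
  proof -
    obtain b where b: "b \<in> M" "?h a = ?h b" using a by blast
    then have "?h (a - b) = \<zero>"
      using free_ring_hom_closed by (simp add: free_ring_hom_simps a_minus_def r_neg)
    then have "a - b \<in> M" using M(2) by blast
    from is_subringD(4)[OF M(1) this b(1)] show ?thesis by simp
  qed
  have no: "T = carrier R" if T: "subring T R" "?h ` M \<subset> T" for T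
  proof -
    have "M \<subset> ?h -` T"
    proof -
      obtain x where x: "x \<in> T" "x \<notin> ?h ` M" using T(2) by blast
      then obtain a where "?h a = x" using free_ring_hom_surj subringE(1)[OF T(1)] by blast
      then show ?thesis using x T(2) by blast
    qed
    then have "?h -` T = UNIV" using max is_subring_vimage[OF T(1)] by blast
    then show ?thesis using free_ring_hom_surj subringE(1)[OF T(1)] by blast
  qed
  have "?h ` M \<noteq> carrier R" using mem M(3) free_ring_hom_closed by blast
  then show ?thesis
    using subring_image[OF M(1)] subringE(1)[OF subring_image[OF M(1)]] no
    unfolding maximal_subring_def by blast
qed

end

theorem corollary1p26:
  fixes R :: "('a, 'm) ring_scheme" (structure)
  assumes "cring R" and "\<one> \<noteq> \<zero>"
    and "reduced_ring R"
    and "zero_characteristic R"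
  shows "submaximal R \<or> (\<Inter>p \<in> {p :: nat. Factorial_Ring.prime p}. PIdl ([p] \<cdot> \<one>)) = {\<zero>}"
proof (rule disjCI)
  interpret cring R by fact
  let ?h = "free_ring_hom R"
  let ?D = "\<Inter>p \<in> {p :: nat. Factorial_Ring.prime p}. PIdl ([p] \<cdot> \<one>)"
  assume "?D \<noteq> {\<zero>}"
  moreover have "\<zero> \<in> ?D" by (auto simp: cgenideal_def intro!: exI[of _ \<zero>])
  ultimately obtain x where x: "x \<in> ?D" "x \<noteq> \<zero>" by blast
  have div: "\<exists>r\<in>carrier R. x = r \<otimes> [p] \<cdot> \<one>" if "Factorial_Ring.prime p" for p :: nat
    using x(1) that unfolding cgenideal_def by blast
  \<comment> \<open>Any prime would do here: divisibility by it places \<open>x\<close> in the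
    carrier.\<close>
  have "x \<in> carrier R" using div[OF two_is_prime_nat] by auto
  then obtain z where z: "?h z = x" using free_ring_hom_surj by blast
  let ?I = "?h -` {\<zero>}"
  have ideal: "is_ideal ?I"
    unfolding is_ideal_def by (auto simp: free_ring_hom_simps free_ring_hom_closed a_minus_def)
  \<comment> \<open>In a reduced ring no power of the nonzero \<open>x\<close> vanishes, so no power
    of its lift \<open>z\<close> lies in the kernel.\<close>
  have power: "z ^ n \<notin> ?I" for n
    using \<open>reduced_ring R\<close> \<open>x \<in> carrier R\<close> x(2)
    unfolding reduced_ring_def by (auto simp: free_ring_hom_power z)
  have divI: "\<exists>r. z - of_nat p * r \<in> ?I" if p: "Factorial_Ring.prime p" for p :: nat
  proof -
    obtain r where r: "r \<in> carrier R" "x = r \<otimes> [p] \<cdot> \<one>" using div[OF p] by blast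
    obtain a where a: "?h a = r" using free_ring_hom_surj r(1) by blast
    have "?h (z - of_nat p * a) = \<zero>"
      using r by (simp add: free_ring_hom_simps free_ring_hom_of_nat z a m_comm a_minus_def r_neg)
    then show ?thesis by blast
  qed
  \<comment> \<open>The maximal subring of the free ring lies above the kernel \<open>?I\<close>, so
    its image is a maximal subring of \<open>R\<close>.\<close>
  show "submaximal R"
    unfolding submaximal_def
    by (rule exists_maximal_subring_above_ideal[OF ideal power divI],
      assumption, rule exI, rule maximal_subring_image)
qed

end
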